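(* Let $r\ge 2$. Then for every $\varepsilon>0$, \[ \sum_{n_1,\ldots,n_r \le x} \tau(n_1\cdots n_r) = x^r P_r(\log x)+ O(x^{r-1+\theta+\varepsilon}),\qquad \sum_{n_1,\ldots,n_r \le x} \tau([n_1,\ldots, n_r]) = x^r Q_r(\log x)+ O(x^{r-1+\theta+\varepsilon}), \] where $P_r(t)$ and $Q_r(t)$ are polynomials in $t$ of degree $r$ with leading coefficients \[ K_{P,r}=\prod_p \left(1-\frac1{p} \right)^{r-1}\left(1+\frac{r-1}{p}\right) \quad\text{and}\quad K_{Q,r}= \prod_p \left(1-\frac1{p}\right)^{2r} \sum_{\nu_1,\ldots,\nu_r=0}^{\infty} \frac{\max(\nu_1,\ldots,\nu_r)+1}{p^{\nu_1+\cdots+ \nu_r}}, \] respectively.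
   Context: $\tau(n)$ is the number of divisors of $n$, $[n_1,\ldots,n_r]$ is the least common multiple, products over $p$ run over primes. $\theta$ denotes an exponent with $1/4\le\theta<1/3$ for which $\sum_{n\le x}\tau(n)=x\log x+(2\gamma-1)x+O(x^{\theta+\varepsilon})$ holds for every $\varepsilon>0$ ($\gamma$ is Euler's constant). *)

theory Defs
  imports
    "HOL-Analysis.Analysis"
    "HOL-Library.Landau_Symbols"
    "HOL-Library.FuncSet"
    "HOL-Computational_Algebra.Computational_Algebra"
begin

definition tau :: "nat \<Rightarrow> nat" where
  "tau n = card {d. d dvd n}"

definition pos_upto :: "real \<Rightarrow> nat set" where
  "pos_upto x = {n. 0 < n \<and> real n \<le> x}"

text \<open>
  A tuple \<open>(n\<^sub>1, \<dots>, n\<^sub>r)\<close> is a function \<open>n\<close> on \<open>{1..r}\<close>. The extensional function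
  space makes each tuple occur exactly once.
\<close>

definition tau_prod_sum :: "nat \<Rightarrow> real \<Rightarrow> real" where
  "tau_prod_sum r x =
     (\<Sum>n \<in> {1..r} \<rightarrow>\<^sub>E pos_upto x. real (tau (\<Prod>i\<in>{1..r}. n i)))"

definition tau_lcm_sum :: "nat \<Rightarrow> real \<Rightarrow> real" where
  "tau_lcm_sum r x =
     (\<Sum>n \<in> {1..r} \<rightarrow>\<^sub>E pos_upto x. real (tau (LCM i\<in>{1..r}. n i)))"

definition K_P_factor :: "nat \<Rightarrow> nat \<Rightarrow> real" where
  "K_P_factor r p = (1 - 1 / real p) ^ (r - 1) * (1 + (real r - 1) / real p)"

definition K_Q_factor :: "nat \<Rightarrow> nat \<Rightarrow> real" where
  "K_Q_factor r p =
     (1 - 1 / real p) ^ (2 * r) *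
     (\<Sum>\<^sub>\<infinity>\<nu> \<in> {1..r} \<rightarrow>\<^sub>E (UNIV :: nat set).
        (real (Max (\<nu> ` {1..r})) + 1) / real p ^ (\<Sum>i\<in>{1..r}. \<nu> i))"

text \<open>
  \<open>has_prime_prod f K\<close> says that the product of \<open>f p\<close> over the primes, taken in increasing
  order, converges to \<open>K\<close>. Unlike an equation with \<^const>\<open>prodinf\<close>, it includes convergence.
\<close>

definition has_prime_prod :: "(nat \<Rightarrow> real) \<Rightarrow> real \<Rightarrow> bool" where
  "has_prime_prod f K \<longleftrightarrow> (\<lambda>p. if prime p then f p else 1) has_prod K"

end

theory Submission imports Defs begin

text \<open>
  Both summands have the form \<open>f n = (\<Prod>p. F (\<nu>\<^sub>p n))\<close>, where \<open>\<nu>\<^sub>p n\<close> is the vector of \<open>p\<close>-adic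
  valuations of the tuple \<open>n\<close> and \<open>F \<nu>\<close> is \<open>1 + (\<Sum>i. \<nu> i)\<close> or \<open>1 + Max \<nu>\<close>. Since \<open>F\<close> agrees with
  \<open>k + 1\<close> on the coordinate axes, writing \<open>f\<close> as a Dirichlet convolution of some \<open>g\<close> with
  \<open>\<tau>(n\<^sub>1) \<cdots> \<tau>(n\<^sub>r)\<close> gives a multiplicative \<open>g\<close> whose local factors live on exponent vectors with at
  least two nonzero entries. Hence the sum of \<open>\<bar>g d\<bar> (\<Prod>i. d\<^sub>i powr - a\<^sub>i)\<close> converges as soon as all
  \<open>a\<^sub>i \<ge> 1/4\<close> and all \<open>a\<^sub>i + a\<^sub>k \<ge> 5/4\<close> (for \<open>i \<noteq> k\<close>).
  Inserting the divisor asymptotics into \<open>(\<Sum>d. g d (\<Prod>i. \<Sum>m \<le> x/d\<^sub>i. \<tau> m))\<close> and replacing one factor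
  at a time by its main term costs \<open>(x/d\<^sub>j) powr (\<theta> + \<epsilon>)\<close> in one coordinate and
  \<open>(x/d\<^sub>i) powr (1 + \<epsilon>)\<close>-type factors in the others; the exponents \<open>\<theta> + \<epsilon>\<close> and \<open>1 - \<epsilon>\<close> of \<open>d\<close> are
  admissible because \<open>\<theta> \<ge> 1/4\<close>. The leading coefficient is the Euler product of the sum of
  \<open>g d / (\<Prod>i. d\<^sub>i)\<close>.
\<close>

section \<open>Infinite sums and the local coefficients\<close>

no_notation Infinite_Set_Sum.abs_summable_on (infix \<open>abs'_summable'_on\<close> 50)

text \<open>Every finite set of functions in \<open>PiE A B\<close> lies in the finite box spanned
  by its coordinate projections. Over that box the sum of norms factors, and each factor is at most
  the full sum over \<open>B x\<close>, so the finite partial sums have a common bound.\<close>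

lemma abs_summable_on_prod_PiE:
  fixes f :: "'a \<Rightarrow> 'b \<Rightarrow> real"
  assumes A: "finite A" and f: "\<And>x. x \<in> A \<Longrightarrow> f x abs_summable_on B x"
  shows "(\<lambda>g. \<Prod>x\<in>A. f x (g x)) abs_summable_on PiE A B"
  unfolding abs_summable_iff_bdd_above
proof (rule bdd_aboveI2)
  fix S assume "S \<in> {F. F \<subseteq> PiE A B \<and> finite F}"
  then have S: "S \<subseteq> PiE A B" "finite S" by auto
  have "(\<Sum>g\<in>S. norm (\<Prod>x\<in>A. f x (g x))) \<le> (\<Sum>g\<in>PiE A (\<lambda>x. (\<lambda>g. g x) ` S). norm (\<Prod>x\<in>A. f x (g x)))"
    using S A by (intro sum_mono2 finite_PiE) (auto simp: PiE_iff subset_iff)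
  also have "\<dots> = (\<Prod>x\<in>A. \<Sum>y\<in>(\<lambda>g. g x) ` S. norm (f x y))"
    using A S by (subst prod_sum_PiE) (auto simp: abs_prod)
  also have "\<dots> \<le> (\<Prod>x\<in>A. infsum (\<lambda>y. norm (f x y)) (B x))"
  proof (rule prod_mono, rule conjI)
    fix x assume "x \<in> A"
    then show "(\<Sum>y\<in>(\<lambda>g. g x) ` S. norm (f x y)) \<le> infsum (\<lambda>y. norm (f x y)) (B x)"
      using S by (intro finite_sum_le_infsum f) auto
  qed (auto intro: sum_nonneg)
  finally show "(\<Sum>g\<in>S. norm (\<Prod>x\<in>A. f x (g x))) \<le> (\<Prod>x\<in>A. infsum (\<lambda>y. norm (f x y)) (B x))" .
qed

lemma abs_summable_on_Times:
  fixes f :: "'a \<Rightarrow> real" and g :: "'b \<Rightarrow> real"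
  assumes "f abs_summable_on A" "g abs_summable_on B"
  shows "(\<lambda>(x, y). f x * g y) abs_summable_on A \<times> B"
  unfolding Infinite_Sum.abs_summable_on_Sigma_iff using assms
  by (auto simp: abs_mult infsum_cmult_right' infsum_nonneg summable_on_cmult_right
      intro: summable_on_cmult_left)

section \<open>Power series in one variable\<close>

lemma has_sum_Suc_mult_power:
  fixes x :: real
  assumes "0 \<le> x" "x < 1"
  shows "((\<lambda>k. real (Suc k) * x ^ k) has_sum (1 / (1 - x)\<^sup>2)) UNIV"
  using assms geometric_deriv_sums[of x] by (intro sums_nonneg_imp_has_sum) auto

lemma has_sum_power:
  fixes x :: real
  assumes "0 \<le> x" "x < 1"
  shows "((\<lambda>k. x ^ k) has_sum (1 / (1 - x))) UNIV"
  using assms geometric_sums[of x] by (intro sums_nonneg_imp_has_sum) auto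

lemma has_sum_mult_power:
  fixes x :: real
  assumes "0 \<le> x" "x < 1"
  shows "((\<lambda>k. real k * x ^ k) has_sum (x / (1 - x)\<^sup>2)) UNIV"
proof -
  have "((\<lambda>k. real (Suc k) * x ^ k - x ^ k) has_sum (1 / (1 - x)\<^sup>2 - 1 / (1 - x))) UNIV"
    using has_sum_add[OF has_sum_Suc_mult_power[OF assms] has_sum_uminusI[OF has_sum_power[OF assms]]]
    by simp
  moreover have "1 / (1 - x)\<^sup>2 - 1 / (1 - x) = x / (1 - x)\<^sup>2"
    using assms by (simp add: divide_simps) (simp add: power2_eq_square algebra_simps)
  ultimately show ?thesis by (simp add: algebra_simps)
qed

text \<open>The coefficients of \<open>(1 - X)\<^sup>2\<close>, the inverse of the generating series of \<open>k + 1\<close>.\<close>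

definition sq_diff_coeff :: "nat \<Rightarrow> real" where
  "sq_diff_coeff k = (if k = 0 then 1 else if k = 1 then - 2 else if k = 2 then 1 else 0)"

lemma sum_sq_diff_coeff: "(\<Sum>l\<le>k. sq_diff_coeff (k - l) * real (Suc l)) = (if k = 0 then 1 else 0)"
proof -
  consider "k = 0" | "k = 1" | m where "k = m + 2"
    by (metis One_nat_def add_2_eq_Suc' not0_implies_Suc)
  then show ?thesis
  proof cases
    case (3 m)
    \<comment> \<open>For \<open>k \<ge> 2\<close> only the last three terms survive; they form the
      second difference of a linear sequence, hence 0.\<close>
    have "(\<Sum>l\<le>k. sq_diff_coeff (k - l) * real (Suc l)) = (\<Sum>l\<in>{m, m+1, m+2}. sq_diff_coeff (k - l) * real (Suc l))"
      unfolding 3 by (intro sum.mono_neutral_right) (auto simp: sq_diff_coeff_def)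
    then show ?thesis by (simp add: 3 sq_diff_coeff_def)
  qed (auto simp: sq_diff_coeff_def)
qed

text \<open>The same inverse relation, started at \<open>l\<close>: this is the inner sum that
  remains once the two summations in \<open>F_eq_conv_G\<close> are interchanged.\<close>

lemma sum_sq_diff_coeff_interval:
  assumes "l \<le> n"
  shows "(\<Sum>k\<in>{l..n}. sq_diff_coeff (k - l) * real (Suc (n - k))) = (if l = n then 1 else 0)"
proof -
  have "(\<Sum>k\<in>{l..n}. sq_diff_coeff (k - l) * real (Suc (n - k)))
      = (\<Sum>j\<le>n - l. sq_diff_coeff ((n - l) - j) * real (Suc j))"
    using assms by (intro sum.reindex_bij_witness[of _ "\<lambda>j. n - j" "\<lambda>k. n - k"]) auto
  with sum_sq_diff_coeff[of "n - l"] assms show ?thesis by simp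
qed

text \<open>Since \<open>l \<le> k\<close>, the linear factor is at most \<open>Suc k\<close>; what
  remains is at most 1 + 2 + 1, the l1 norm of the coefficients of (1 - X)^2.\<close>

lemma sum_abs_sq_diff_coeff: "(\<Sum>l\<le>k. \<bar>sq_diff_coeff (k - l)\<bar> * real (Suc l)) \<le> 4 * real (Suc k)"
proof -
  have "(\<Sum>l\<le>k. \<bar>sq_diff_coeff (k - l)\<bar> * real (Suc l)) \<le> (\<Sum>l\<le>k. \<bar>sq_diff_coeff (k - l)\<bar> * real (Suc k))"
    by (intro sum_mono mult_left_mono) auto
  also have "\<dots> = (\<Sum>l\<le>k. \<bar>sq_diff_coeff (k - l)\<bar>) * real (Suc k)"
    by (simp add: sum_distrib_right)
  also have "(\<Sum>l\<le>k. \<bar>sq_diff_coeff (k - l)\<bar>) = (\<Sum>l\<le>k. \<bar>sq_diff_coeff l\<bar>)"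
    by (intro sum.reindex_bij_witness[of _ "\<lambda>j. k - j" "\<lambda>j. k - j"]) auto
  also have "\<dots> = (\<Sum>l\<in>{..k} \<inter> {0,1,2}. \<bar>sq_diff_coeff l\<bar>)"
    by (rule sum.mono_neutral_right) (auto simp: sq_diff_coeff_def)
  also have "\<dots> \<le> (\<Sum>l\<in>{0,1,2}. \<bar>sq_diff_coeff l\<bar>)"
    by (rule sum_mono2) auto
  also have "\<dots> = 4" by (simp add: sq_diff_coeff_def)
  finally show ?thesis by (simp add: mult_right_mono)
qed

lemma has_sum_sq_diff_coeff: "((\<lambda>k. sq_diff_coeff k * x ^ k) has_sum (1 - x)\<^sup>2) UNIV"
  by (rule has_sum_finite_neutralI[where B = "{0,1,2}"])
     (auto simp: sq_diff_coeff_def power2_eq_square algebra_simps)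

text \<open>One framework for both sums. \<open>F_axis\<close> will force the coefficients
  \<open>G\<close> to vanish on the axes away from the origin; \<open>F_nonneg\<close> and
  \<open>F_le\<close> keep their growth polynomial. Vectors are extensional so that each is
  represented by exactly one function.\<close>

locale local_factor =
  fixes I :: "'a set" and F :: "('a \<Rightarrow> nat) \<Rightarrow> real"
  assumes finite_I: "finite I" and I_nonempty: "I \<noteq> {}"
    and F_axis: "\<And>i \<nu>. i \<in> I \<Longrightarrow> \<nu> \<in> extensional I \<Longrightarrow> (\<And>j. j \<in> I - {i} \<Longrightarrow> \<nu> j = 0) \<Longrightarrow> F \<nu> = real (Suc (\<nu> i))"
    and F_nonneg: "\<And>\<nu>. \<nu> \<in> extensional I \<Longrightarrow> 0 \<le> F \<nu>"
    and F_le: "\<And>\<nu>. \<nu> \<in> extensional I \<Longrightarrow> F \<nu> \<le> (\<Prod>i\<in>I. real (Suc (\<nu> i)))"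
begin

section \<open>Convolution coefficients at one prime\<close>

definition exps :: "('a \<Rightarrow> nat) set" where "exps = (I \<rightarrow>\<^sub>E UNIV)"

definition box :: "('a \<Rightarrow> nat) \<Rightarrow> ('a \<Rightarrow> nat) set" where "box \<nu> = (\<Pi>\<^sub>E i\<in>I. {..\<nu> i})"

text \<open>Coefficients of the power series of \<open>F\<close> in variables X_i, multiplied by the
  product of all (1 - X_i)^2. This undoes convolution with the product of the
  \<open>Suc (\<nu> i)\<close>, the local form of tau(n_1) ... tau(n_r).\<close>

definition G :: "('a \<Rightarrow> nat) \<Rightarrow> real" where
  "G \<kappa> = (\<Sum>\<mu>\<in>box \<kappa>. F \<mu> * (\<Prod>i\<in>I. sq_diff_coeff (\<kappa> i - \<mu> i)))"

lemma finite_box [simp, intro]: "finite (box \<nu>)"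
  unfolding box_def using finite_I by (intro finite_PiE) auto

lemma box_exps: "\<mu> \<in> box \<nu> \<Longrightarrow> \<mu> \<in> exps"
  by (auto simp: box_def exps_def PiE_def)

lemma exps_ext: "\<mu> \<in> exps \<Longrightarrow> \<mu> \<in> extensional I"
  by (auto simp: exps_def PiE_def)

lemma box_ext: "\<mu> \<in> box \<nu> \<Longrightarrow> \<mu> \<in> extensional I"
  by (auto simp: box_def PiE_def)

text \<open>Insert the definition of \<open>G\<close> and sum over \<open>\<kappa>\<close> first.
  For fixed \<open>\<mu>\<close> the sum over the vectors between \<open>\<mu>\<close> and
  \<open>\<nu>\<close> factors over \<open>I\<close> into the sums of
  \<open>sum_sq_diff_coeff_interval\<close>, so only \<open>\<mu> = \<nu>\<close> survives.\<close>

lemma F_eq_conv_G: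
  assumes "\<nu> \<in> exps"
  shows "F \<nu> = (\<Sum>\<kappa>\<in>box \<nu>. G \<kappa> * (\<Prod>i\<in>I. real (Suc (\<nu> i - \<kappa> i))))"
proof -
  let ?t = "\<lambda>\<kappa>. \<Prod>i\<in>I. real (Suc (\<nu> i - \<kappa> i))"
  let ?c = "\<lambda>\<kappa> \<mu>. \<Prod>i\<in>I. sq_diff_coeff (\<kappa> i - \<mu> i)"
  have "(\<Sum>\<kappa>\<in>box \<nu>. G \<kappa> * ?t \<kappa>) = (\<Sum>\<kappa>\<in>box \<nu>. \<Sum>\<mu>\<in>box \<kappa>. F \<mu> * (?c \<kappa> \<mu> * ?t \<kappa>))"
    by (simp add: G_def sum_distrib_right mult.assoc)
  also have "\<dots> = (\<Sum>(\<kappa>,\<mu>)\<in>(SIGMA \<kappa>:box \<nu>. box \<kappa>). F \<mu> * (?c \<kappa> \<mu> * ?t \<kappa>))"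
    by (subst sum.Sigma) auto
  also have "\<dots> = (\<Sum>(\<mu>,\<kappa>)\<in>(SIGMA \<mu>:box \<nu>. (\<Pi>\<^sub>E i\<in>I. {\<mu> i..\<nu> i})). F \<mu> * (?c \<kappa> \<mu> * ?t \<kappa>))"
    by (rule sum.reindex_bij_witness[of _ prod.swap prod.swap])
       (fastforce simp: box_def PiE_iff intro: order_trans)+
  also have "\<dots> = (\<Sum>\<mu>\<in>box \<nu>. \<Sum>\<kappa>\<in>(\<Pi>\<^sub>E i\<in>I. {\<mu> i..\<nu> i}). F \<mu> * (?c \<kappa> \<mu> * ?t \<kappa>))"
    using finite_I by (subst sum.Sigma) (auto intro!: finite_PiE)
  also have "\<dots> = (\<Sum>\<mu>\<in>box \<nu>. F \<mu> * (\<Prod>i\<in>I. \<Sum>k\<in>{\<mu> i..\<nu> i}. sq_diff_coeff (k - \<mu> i) * real (Suc (\<nu> i - k))))"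
    using finite_I by (subst prod_sum_PiE) (auto simp: sum_distrib_left prod.distrib)
  also have "\<dots> = (\<Sum>\<mu>\<in>box \<nu>. F \<mu> * (\<Prod>i\<in>I. if \<mu> i = \<nu> i then 1 else 0))"
    by (intro sum.cong arg_cong2[of _ _ _ _ "(*)"] refl prod.cong, subst sum_sq_diff_coeff_interval)
       (auto simp: box_def)
  also have "\<dots> = (\<Sum>\<mu>\<in>{\<nu>}. F \<mu> * (\<Prod>i\<in>I. if \<mu> i = \<nu> i then 1 else 0))"
  proof (rule sum.mono_neutral_right)
    show "\<forall>\<mu>\<in>box \<nu> - {\<nu>}. F \<mu> * (\<Prod>i\<in>I. if \<mu> i = \<nu> i then 1 else 0) = 0"
    proof safe
      fix \<mu> assume \<mu>: "\<mu> \<in> box \<nu>" "F \<mu> * (\<Prod>i\<in>I. if \<mu> i = \<nu> i then 1 else 0) \<noteq> 0" 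
      then have "\<forall>i\<in>I. \<mu> i = \<nu> i" using finite_I by (auto split: if_splits)
      then show "\<mu> = \<nu>" using \<mu>(1) assms by (auto simp: box_def exps_def intro: PiE_ext)
    qed
  qed (use assms in \<open>auto simp: box_def exps_def intro: finite_box[unfolded box_def]\<close>)
  finally show ?thesis by simp
qed

text \<open>The box below a vector on an axis stays on that axis, where \<open>F\<close> equals the
  product of the \<open>Suc (\<mu> i)\<close>. Convolving that product with its inverse leaves only
  the origin.\<close>

lemma G_axis:
  assumes "\<kappa> \<in> exps" "i \<in> I" "\<And>j. j \<in> I - {i} \<Longrightarrow> \<kappa> j = 0"
  shows "G \<kappa> = (if \<kappa> i = 0 then 1 else 0)"
proof -
  have "G \<kappa> = (\<Sum>\<mu>\<in>box \<kappa>. (\<Prod>i\<in>I. real (Suc (\<mu> i))) * (\<Prod>i\<in>I. sq_diff_coeff (\<kappa> i - \<mu> i)))"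
    unfolding G_def
  proof (intro sum.cong refl arg_cong2[of _ _ _ _ "(*)"])
    fix \<mu> assume \<mu>: "\<mu> \<in> box \<kappa>"
    then have z: "\<mu> j = 0" if "j \<in> I - {i}" for j
      using assms(3)[OF that] that by (force simp: box_def)
    then have "F \<mu> = real (Suc (\<mu> i))"
      using box_ext[OF \<mu>] by (intro F_axis[OF assms(2)]) auto
    also have "\<dots> = (\<Prod>i\<in>I. real (Suc (\<mu> i)))"
      using z finite_I assms(2) by (subst prod.remove[of _ i]) auto
    finally show "F \<mu> = (\<Prod>i\<in>I. real (Suc (\<mu> i)))" .
  qed
  also have "\<dots> = (\<Prod>i\<in>I. \<Sum>l\<le>\<kappa> i. sq_diff_coeff (\<kappa> i - l) * real (Suc l))"
    using finite_I by (subst prod_sum_PiE) (auto simp: box_def prod.distrib mult.commute)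
  also have "\<dots> = (\<Prod>i\<in>I. if \<kappa> i = 0 then 1 else 0)"
    by (intro prod.cong refl sum_sq_diff_coeff)
  also have "\<dots> = (if \<kappa> i = 0 then 1 else 0)"
    using finite_I assms(2,3) by (subst prod.remove[of _ i]) auto
  finally show ?thesis .
qed

text \<open>The bound 4 of \<open>sum_abs_sq_diff_coeff\<close> enters once per coordinate. Growth
  this slow makes the power series of \<open>G\<close> converge absolutely on [0, 1).\<close>

lemma abs_G_le: "\<bar>G \<kappa>\<bar> \<le> 4 ^ card I * (\<Prod>i\<in>I. real (Suc (\<kappa> i)))"
proof -
  have "\<bar>G \<kappa>\<bar> \<le> (\<Sum>\<mu>\<in>box \<kappa>. \<bar>F \<mu> * (\<Prod>i\<in>I. sq_diff_coeff (\<kappa> i - \<mu> i))\<bar>)"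
    unfolding G_def by (rule sum_abs)
  also have "\<dots> \<le> (\<Sum>\<mu>\<in>box \<kappa>. (\<Prod>i\<in>I. real (Suc (\<mu> i))) * (\<Prod>i\<in>I. \<bar>sq_diff_coeff (\<kappa> i - \<mu> i)\<bar>))"
    using F_nonneg F_le by (intro sum_mono) (auto simp: abs_mult abs_prod box_ext intro!: mult_right_mono prod_nonneg)
  also have "\<dots> = (\<Prod>i\<in>I. \<Sum>l\<le>\<kappa> i. \<bar>sq_diff_coeff (\<kappa> i - l)\<bar> * real (Suc l))"
    using finite_I by (subst prod_sum_PiE) (auto simp: box_def prod.distrib mult.commute)
  also have "\<dots> \<le> (\<Prod>i\<in>I. 4 * real (Suc (\<kappa> i)))"
    by (intro prod_mono conjI sum_abs_sq_diff_coeff sum_nonneg) auto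
  also have "\<dots> = 4 ^ card I * (\<Prod>i\<in>I. real (Suc (\<kappa> i)))"
    by (simp only: prod.distrib prod_constant)
  finally show ?thesis .
qed

lemma abs_summable_G_power:
  assumes "0 \<le> x" "x < 1"
  shows "(\<lambda>\<kappa>. G \<kappa> * x ^ (\<Sum>i\<in>I. \<kappa> i)) abs_summable_on exps"
proof -
  have "(\<lambda>\<kappa>. \<Prod>i\<in>I. real (Suc (\<kappa> i)) * x ^ \<kappa> i) abs_summable_on exps"
    unfolding exps_def
    using has_sum_Suc_mult_power[OF assms] assms finite_I
    by (intro abs_summable_on_prod_PiE) (auto simp: summable_on_def)
  then have "(\<lambda>\<kappa>. 4 ^ card I * (\<Prod>i\<in>I. real (Suc (\<kappa> i)) * x ^ \<kappa> i)) summable_on exps"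
    by (intro summable_on_cmult_right) (rule abs_summable_summable)
  then show ?thesis
  proof (rule Infinite_Sum.abs_summable_on_comparison_test')
    fix \<kappa>
    show "norm (G \<kappa> * x ^ (\<Sum>i\<in>I. \<kappa> i)) \<le> 4 ^ card I * (\<Prod>i\<in>I. real (Suc (\<kappa> i)) * x ^ \<kappa> i)"
      using abs_G_le[of \<kappa>] assms
      by (simp only: real_norm_def abs_mult prod.distrib power_sum abs_prod power_abs abs_of_nonneg
          mult.assoc[symmetric]) (intro mult_right_mono prod_nonneg, auto)
  qed
qed

lemma abs_summable_F_power:
  assumes "0 \<le> x" "x < 1"
  shows "(\<lambda>\<kappa>. F \<kappa> * x ^ (\<Sum>i\<in>I. \<kappa> i)) abs_summable_on exps"
proof -
  have "(\<lambda>\<kappa>. \<Prod>i\<in>I. real (Suc (\<kappa> i)) * x ^ \<kappa> i) summable_on exps"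
    unfolding exps_def
    using has_sum_Suc_mult_power[OF assms] assms finite_I
    by (intro abs_summable_summable[OF abs_summable_on_prod_PiE]) (auto simp: summable_on_def)
  then show ?thesis
  proof (rule Infinite_Sum.abs_summable_on_comparison_test')
    fix \<kappa> assume "\<kappa> \<in> exps"
    then have "\<bar>F \<kappa>\<bar> \<le> (\<Prod>i\<in>I. real (Suc (\<kappa> i)))"
      using F_nonneg[of \<kappa>] F_le[of \<kappa>] by (simp add: exps_ext)
    then show "norm (F \<kappa> * x ^ (\<Sum>i\<in>I. \<kappa> i)) \<le> (\<Prod>i\<in>I. real (Suc (\<kappa> i)) * x ^ \<kappa> i)"
      using assms
      by (simp only: real_norm_def abs_mult prod.distrib power_sum abs_prod power_abs abs_of_nonneg)
         (intro mult_right_mono prod_nonneg, auto)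
  qed
qed

text \<open>Multiplication of absolutely convergent series: pairs of a vector \<open>\<nu>\<close>
  from the series of \<open>F\<close> and a vector \<open>\<delta>\<close> from the product of the
  (1 - x)^2 are regrouped by their sum \<open>\<kappa>\<close>, and the inner sum is then
  \<open>G \<kappa>\<close>.\<close>

lemma infsum_G_power:
  assumes "0 \<le> x" "x < 1"
  shows "infsum (\<lambda>\<kappa>. G \<kappa> * x ^ (\<Sum>i\<in>I. \<kappa> i)) exps
       = (1 - x) ^ (2 * card I) * infsum (\<lambda>\<nu>. F \<nu> * x ^ (\<Sum>i\<in>I. \<nu> i)) exps"
proof -
  let ?f = "\<lambda>\<nu>. F \<nu> * x ^ (\<Sum>i\<in>I. \<nu> i)"
  let ?c = "\<lambda>\<delta>. \<Prod>i\<in>I. sq_diff_coeff (\<delta> i) * x ^ \<delta> i"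
  let ?h = "\<lambda>(\<nu>, \<delta>). ?f \<nu> * ?c \<delta>"
  have c1: "(\<lambda>k. sq_diff_coeff k * x ^ k) abs_summable_on UNIV"
    by (rule finite_nonzero_values_imp_summable_on, rule finite_subset[of _ "{0,1,2}"])
       (auto simp: sq_diff_coeff_def)
  have c: "?c abs_summable_on exps"
    unfolding exps_def using finite_I c1 by (intro abs_summable_on_prod_PiE) auto
  have h: "?h abs_summable_on exps \<times> exps"
    by (intro abs_summable_on_Times abs_summable_F_power assms c)
  have "infsum ?h (exps \<times> exps) = infsum (\<lambda>\<nu>. infsum (\<lambda>\<delta>. ?f \<nu> * ?c \<delta>) exps) exps"
    using infsum_Sigma'_banach[of "\<lambda>\<nu> \<delta>. ?f \<nu> * ?c \<delta>", OF abs_summable_summable[OF h]] by simp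
  also have "\<dots> = infsum ?f exps * infsum ?c exps"
    by (simp add: infsum_cmult_right' infsum_cmult_left')
  also have "infsum ?c exps = (\<Prod>i\<in>I. infsum (\<lambda>k. sq_diff_coeff k * x ^ k) UNIV)"
    unfolding exps_def using finite_I c1 by (intro infsum_prod_PiE_abs) auto
  also have "\<dots> = (1 - x) ^ (2 * card I)"
    using has_sum_sq_diff_coeff[of x] by (simp add: infsumI power_mult)
  finally have 1: "infsum ?h (exps \<times> exps) = (1 - x) ^ (2 * card I) * infsum ?f exps"
    by simp
  let ?k = "\<lambda>(\<kappa>, \<mu>). F \<mu> * (\<Prod>i\<in>I. sq_diff_coeff (\<kappa> i - \<mu> i)) * x ^ (\<Sum>i\<in>I. \<kappa> i)"
  let ?S = "SIGMA \<kappa>:exps. box \<kappa>"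
  \<comment> \<open>On \<open>box \<kappa>\<close> the truncated subtraction is exact, so addition
    inverts the map.\<close>
  have bij: "bij_betw (\<lambda>(\<kappa>, \<mu>). (\<mu>, \<lambda>i\<in>I. \<kappa> i - \<mu> i)) ?S (exps \<times> exps)"
    by (rule bij_betwI[where g = "\<lambda>(\<nu>, \<delta>). (\<lambda>i\<in>I. \<nu> i + \<delta> i, \<nu>)"])
       (auto simp: exps_def box_def PiE_iff extensional_def fun_eq_iff)
  have eq: "?h (case y of (\<kappa>, \<mu>) \<Rightarrow> (\<mu>, \<lambda>i\<in>I. \<kappa> i - \<mu> i)) = ?k y" if "y \<in> ?S" for y
  proof -
    obtain \<kappa> \<mu> where y: "y = (\<kappa>, \<mu>)" "\<mu> \<in> box \<kappa>" using \<open>y \<in> ?S\<close> by auto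
    have "(\<Prod>i\<in>I. x ^ \<mu> i) * (\<Prod>i\<in>I. x ^ (\<kappa> i - \<mu> i)) = (\<Prod>i\<in>I. x ^ \<kappa> i)"
      unfolding prod.distrib[symmetric] power_add[symmetric]
      using y(2) by (intro prod.cong) (auto simp: box_def PiE_iff)
    then show ?thesis unfolding y(1)
      by (simp add: prod.distrib power_sum mult_ac) 
  qed
  have k: "?k summable_on ?S"
    using summable_on_reindex_bij_betw[OF bij, of ?h] abs_summable_summable[OF h] summable_on_cong[of ?S, OF eq] by simp
  have "infsum ?h (exps \<times> exps) = infsum ?k ?S"
    using infsum_reindex_bij_betw[OF bij, of ?h] infsum_cong[of ?S, OF eq] by simp
  also have "\<dots> = infsum (\<lambda>\<kappa>. infsum (\<lambda>\<mu>. ?k (\<kappa>, \<mu>)) (box \<kappa>)) exps"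
    using infsum_Sigma_banach[OF k] by simp
  also have "\<dots> = infsum (\<lambda>\<kappa>. G \<kappa> * x ^ (\<Sum>i\<in>I. \<kappa> i)) exps"
    by (intro infsum_cong) (simp add: G_def sum_distrib_right)
  finally show ?thesis using 1 by simp
qed

end

section \<open>Tuples and their prime exponents\<close>

lemma prime_factors_prod_powers:
  fixes f :: "nat \<Rightarrow> nat"
  assumes "finite P" "\<And>p. p \<in> P \<Longrightarrow> prime p"
  shows "prime_factors (\<Prod>p\<in>P. p ^ f p) \<subseteq> P"
  using assms by (auto simp: prime_factors_multiplicity multiplicity_prod_prime_powers split: if_splits)

lemma eq_if_multiplicity_eq_on:
  fixes m n :: nat
  assumes "m > 0" "n > 0" "prime_factors m \<subseteq> P" "prime_factors n \<subseteq> P"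
    and "\<And>p. p \<in> P \<Longrightarrow> multiplicity p m = multiplicity p n"
  shows "m = n"
proof (rule multiplicity_eq_nat[OF assms(1,2)])
  fix p :: nat assume "prime p"
  show "multiplicity p m = multiplicity p n"
  proof (cases "p \<in> P")
    case False
    then have "p \<notin> prime_factors m" "p \<notin> prime_factors n" using assms by auto
    then show ?thesis using \<open>prime p\<close> by (simp add: prime_factors_multiplicity)
  qed (use assms in simp)
qed

lemma dvd_iff_multiplicity_le_on:
  fixes m n :: nat
  assumes "m > 0" "n > 0" "prime_factors m \<subseteq> P"
  shows "m dvd n \<longleftrightarrow> (\<forall>p\<in>P. multiplicity p m \<le> multiplicity p n)"
proof
  assume le: "\<forall>p\<in>P. multiplicity p m \<le> multiplicity p n"
  show "m dvd n"
  proof (rule multiplicity_le_imp_dvd)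
    fix p :: nat assume "prime p"
    show "multiplicity p m \<le> multiplicity p n"
      using le assms(3) \<open>prime p\<close> by (cases "p \<in> P") (auto simp: prime_factors_multiplicity subset_iff)
  qed (use assms in auto)
qed (use assms in \<open>auto intro: dvd_imp_multiplicity_le\<close>)

lemma multiplicity_div:
  fixes m n :: nat
  assumes "d dvd n" "n > 0" "prime p"
  shows "multiplicity p (n div d) = multiplicity p n - multiplicity p d"
proof -
  obtain k where k: "n = d * k" using assms(1) by auto
  with assms show ?thesis by (auto simp: prime_elem_multiplicity_mult_distrib)
qed

text \<open>Divisors correspond to exponent functions below that of \<open>n\<close>. The set
  \<open>P\<close> may exceed the prime factors of \<open>n\<close>: extra primes contribute
  \<open>Suc 0\<close>, so all numbers derived from one tuple can share one
  \<open>P\<close>.\<close>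

lemma tau_eq_prod:
  assumes "n > 0" "finite P" "\<And>p. p \<in> P \<Longrightarrow> prime p" "prime_factors n \<subseteq> P"
  shows "tau n = (\<Prod>p\<in>P. Suc (multiplicity p n))"
proof -
  have "bij_betw (\<lambda>d. \<lambda>p\<in>P. multiplicity p d) {d. d dvd n} (\<Pi>\<^sub>E p\<in>P. {..multiplicity p n})"
  proof (rule bij_betwI[where g = "\<lambda>\<phi>. \<Prod>p\<in>P. p ^ \<phi> p"])
    show "(\<lambda>d. \<lambda>p\<in>P. multiplicity p d) \<in> {d. d dvd n} \<rightarrow> (\<Pi>\<^sub>E p\<in>P. {..multiplicity p n})"
      using assms(1) by (auto intro: dvd_imp_multiplicity_le)
    have pos: "(\<Prod>p\<in>P. p ^ \<phi> p) > 0" for \<phi> :: "nat \<Rightarrow> nat"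
      using assms by (intro prod_pos) (auto simp: prime_gt_0_nat)
    show "(\<lambda>\<phi>. \<Prod>p\<in>P. p ^ \<phi> p) \<in> (\<Pi>\<^sub>E p\<in>P. {..multiplicity p n}) \<rightarrow> {d. d dvd n}"
    proof
      fix \<phi> assume "\<phi> \<in> (\<Pi>\<^sub>E p\<in>P. {..multiplicity p n})"
      then show "(\<Prod>p\<in>P. p ^ \<phi> p) \<in> {d. d dvd n}"
        using assms pos prime_factors_prod_powers[of P \<phi>]
        by (auto simp: dvd_iff_multiplicity_le_on[where P = P] multiplicity_prod_prime_powers PiE_iff)
    qed
    show "(\<Prod>p\<in>P. p ^ restrict (\<lambda>p. multiplicity p d) P p) = d" if "d \<in> {d. d dvd n}" for d
    proof (rule eq_if_multiplicity_eq_on[where P = P])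
      have "d dvd n" using that by simp
      then show "d > 0" using assms(1) by (auto intro: Nat.gr0I)
      show "prime_factors d \<subseteq> P"
        using assms dvd_prime_factors[OF _ \<open>d dvd n\<close>] by auto
    qed (use assms pos prime_factors_prod_powers[of P] in \<open>auto simp: multiplicity_prod_prime_powers\<close>)
    show "(\<lambda>p\<in>P. multiplicity p (\<Prod>p\<in>P. p ^ \<phi> p)) = \<phi>" if "\<phi> \<in> (\<Pi>\<^sub>E p\<in>P. {..multiplicity p n})" for \<phi>
      using that assms by (auto simp: multiplicity_prod_prime_powers PiE_iff extensional_def fun_eq_iff)
  qed
  then have "card {d. d dvd n} = card (\<Pi>\<^sub>E p\<in>P. {..multiplicity p n})"
    by (rule bij_betw_same_card)
  also have "\<dots> = (\<Prod>p\<in>P. Suc (multiplicity p n))"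
    using assms(2) by (simp add: card_PiE)
  finally show ?thesis by (simp add: tau_def)
qed

section \<open>Multiplicative functions of tuples\<close>

context local_factor
begin

definition tuples :: "('a \<Rightarrow> nat) set" where "tuples = (I \<rightarrow>\<^sub>E {0<..})"

definition supp :: "('a \<Rightarrow> nat) \<Rightarrow> nat set" where "supp n = prime_factors (\<Prod>i\<in>I. n i)"

definition mexp :: "('a \<Rightarrow> nat) \<Rightarrow> nat \<Rightarrow> 'a \<Rightarrow> nat" where
  "mexp n p = (\<lambda>i\<in>I. multiplicity p (n i))"

text \<open>The multiplicative function of several variables with local values \<open>H\<close>.
  When \<open>H\<close> is 1 at the zero vector, \<open>supp n\<close> may be replaced by any larger
  finite set of primes.\<close>

definition euler :: "(('a \<Rightarrow> nat) \<Rightarrow> real) \<Rightarrow> ('a \<Rightarrow> nat) \<Rightarrow> real" where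
  "euler H n = (\<Prod>p\<in>supp n. H (mexp n p))"

definition smooth :: "nat set \<Rightarrow> ('a \<Rightarrow> nat) set" where
  "smooth P = {n \<in> tuples. supp n \<subseteq> P}"

definition enc :: "nat set \<Rightarrow> ('a \<Rightarrow> nat) \<Rightarrow> nat \<Rightarrow> 'a \<Rightarrow> nat" where
  "enc P n = (\<lambda>p\<in>P. mexp n p)"

lemma finite_supp [simp, intro]: "finite (supp n)"
  by (simp add: supp_def)

lemma prime_supp: "p \<in> supp n \<Longrightarrow> prime p"
  by (auto simp: supp_def)

lemma tuples_pos: "n \<in> tuples \<Longrightarrow> i \<in> I \<Longrightarrow> n i > 0"
  by (auto simp: tuples_def)

lemma mexp_in_exps [simp, intro]: "mexp n p \<in> exps"
  by (simp add: mexp_def exps_def)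

lemma supp_subset_iff:
  assumes "n \<in> tuples"
  shows "supp n \<subseteq> P \<longleftrightarrow> (\<forall>i\<in>I. prime_factors (n i) \<subseteq> P)"
proof -
  have "supp n = (\<Union>i\<in>I. prime_factors (n i))"
  proof -
    have "(\<Prod>i\<in>I. n i) \<noteq> 0" "\<forall>i\<in>I. n i \<noteq> 0"
      using finite_I tuples_pos[OF assms] by auto
    then show ?thesis
      unfolding supp_def using finite_I by (auto simp: prime_factors_dvd prime_dvd_prod_iff)
  qed
  then show ?thesis by auto
qed

lemma mexp_eq_0:
  assumes "n \<in> tuples" "prime p" "p \<notin> supp n"
  shows "mexp n p = (\<lambda>i\<in>I. 0)"
  unfolding mexp_def
proof (rule restrict_ext)
  fix i assume "i \<in> I"
  then have "p \<notin> prime_factors (n i)" using supp_subset_iff[of n "supp n"] assms by blast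
  then show "multiplicity p (n i) = 0" using assms(2) by (simp add: prime_factors_multiplicity)
qed

lemma euler_eq:
  assumes "n \<in> smooth P" "finite P" "\<And>p. p \<in> P \<Longrightarrow> prime p" "H (\<lambda>i\<in>I. 0) = 1"
  shows "euler H n = (\<Prod>p\<in>P. H (mexp n p))"
  unfolding euler_def using assms
  by (intro prod.mono_neutral_left) (auto simp: smooth_def mexp_eq_0)

text \<open>Unique factorization in each coordinate; the inverse rebuilds every entry from its prime
  powers. Sums over \<open>smooth P\<close> thereby become sums over a product of exponent sets,
  which factor prime by prime.\<close>

lemma bij_betw_enc:
  assumes P: "finite P" "\<And>p. p \<in> P \<Longrightarrow> prime p"
  shows "bij_betw (enc P) (smooth P) (P \<rightarrow>\<^sub>E exps)"
proof (rule bij_betwI[where g = "\<lambda>\<phi>. \<lambda>i\<in>I. \<Prod>p\<in>P. p ^ \<phi> p i"])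
  have pos: "(\<Prod>p\<in>P. p ^ \<phi> p) > 0" for \<phi> :: "nat \<Rightarrow> nat"
    using P by (intro prod_pos) (auto simp: prime_gt_0_nat)
  show "enc P \<in> smooth P \<rightarrow> (P \<rightarrow>\<^sub>E exps)"
    by (auto simp: enc_def)
  have sm: "(\<lambda>i\<in>I. \<Prod>p\<in>P. p ^ \<phi> p i) \<in> smooth P" for \<phi> :: "nat \<Rightarrow> 'a \<Rightarrow> nat"
  proof -
    have t: "(\<lambda>i\<in>I. \<Prod>p\<in>P. p ^ \<phi> p i) \<in> tuples"
      using pos by (auto simp: tuples_def)
    moreover have "supp (\<lambda>i\<in>I. \<Prod>p\<in>P. p ^ \<phi> p i) \<subseteq> P"
      unfolding supp_subset_iff[OF t] using prime_factors_prod_powers[OF P] by auto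
    ultimately show ?thesis by (simp add: smooth_def)
  qed
  then show "(\<lambda>\<phi>. \<lambda>i\<in>I. \<Prod>p\<in>P. p ^ \<phi> p i) \<in> (P \<rightarrow>\<^sub>E exps) \<rightarrow> smooth P"
    by auto
  show "(\<lambda>i\<in>I. \<Prod>p\<in>P. p ^ enc P n p i) = n" if n: "n \<in> smooth P" for n
  proof (rule ext)
    fix i show "(\<lambda>i\<in>I. \<Prod>p\<in>P. p ^ enc P n p i) i = n i"
    proof (cases "i \<in> I")
      case True
      have "(\<Prod>p\<in>P. p ^ enc P n p i) = n i"
      proof (rule eq_if_multiplicity_eq_on[where P = P])
        show "n i > 0" "prime_factors (n i) \<subseteq> P"
          using n True supp_subset_iff[of n] by (auto simp: smooth_def tuples_pos)
      qed (use P True pos prime_factors_prod_powers[OF P] in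
            \<open>auto simp: multiplicity_prod_prime_powers enc_def mexp_def\<close>)
      then show ?thesis using True by simp
    next
      case False
      then show ?thesis using n by (auto simp: smooth_def tuples_def PiE_def extensional_def)
    qed
  qed
  show "enc P (\<lambda>i\<in>I. \<Prod>p\<in>P. p ^ \<phi> p i) = \<phi>" if "\<phi> \<in> (P \<rightarrow>\<^sub>E exps)" for \<phi>
  proof (intro ext)
    fix p i
    consider "p \<notin> P" | "p \<in> P" "i \<notin> I" | "p \<in> P" "i \<in> I" by blast
    then show "enc P (\<lambda>i\<in>I. \<Prod>p\<in>P. p ^ \<phi> p i) p i = \<phi> p i"
    proof cases
      case 1
      with that show ?thesis by (auto simp: enc_def PiE_iff extensional_def)
    next
      case 2
      with that have "\<phi> p \<in> exps" by auto
      with 2 show ?thesis by (auto simp: enc_def mexp_def exps_def PiE_iff extensional_def)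
    next
      case 3
      then show ?thesis using P by (simp add: enc_def mexp_def multiplicity_prod_prime_powers)
    qed
  qed
qed

section \<open>Divisor tuples and the global convolution\<close>

definition divisors :: "('a \<Rightarrow> nat) \<Rightarrow> ('a \<Rightarrow> nat) set" where
  "divisors n = (\<Pi>\<^sub>E i\<in>I. {d. d dvd n i})"

lemma divisors_tuples: "n \<in> tuples \<Longrightarrow> d \<in> divisors n \<Longrightarrow> d \<in> tuples"
  by (auto simp: divisors_def tuples_def PiE_iff intro: dvd_pos_nat)

lemma divisors_smooth:
  assumes "n \<in> smooth P" "d \<in> divisors n"
  shows "d \<in> smooth P"
proof -
  have d: "d \<in> tuples" using assms divisors_tuples by (auto simp: smooth_def)
  have "prime_factors (d i) \<subseteq> P" if "i \<in> I" for i
  proof -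
    have "d i dvd n i" "n i > 0" using that assms by (auto simp: divisors_def smooth_def tuples_pos)
    then have "prime_factors (d i) \<subseteq> prime_factors (n i)" by (intro dvd_prime_factors) auto
    also have "\<dots> \<subseteq> P" using assms(1) that supp_subset_iff[of n] by (auto simp: smooth_def)
    finally show ?thesis .
  qed
  with d show ?thesis by (auto simp: smooth_def supp_subset_iff)
qed

lemma enc_mem_box_iff:
  assumes "n \<in> smooth P" "d \<in> smooth P"
  shows "enc P d \<in> (\<Pi>\<^sub>E p\<in>P. box (mexp n p)) \<longleftrightarrow> d \<in> divisors n"
proof -
  have "d i dvd n i \<longleftrightarrow> (\<forall>p\<in>P. multiplicity p (d i) \<le> multiplicity p (n i))" if "i \<in> I" for i
    using assms supp_subset_iff[of d] that
    by (intro dvd_iff_multiplicity_le_on) (auto simp: smooth_def tuples_pos)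
  moreover have "d \<in> extensional I" using assms(2) by (auto simp: smooth_def tuples_def PiE_def)
  ultimately show ?thesis
    by (auto simp: enc_def divisors_def PiE_iff box_def mexp_def)
qed

text \<open>Divisibility of the entries is inequality of exponents at every prime of
  \<open>P\<close>, so choosing a divisor tuple means choosing a box element independently at each
  prime.\<close>

lemma bij_betw_enc_divisors:
  assumes P: "finite P" "\<And>p. p \<in> P \<Longrightarrow> prime p" and n: "n \<in> smooth P"
  shows "bij_betw (enc P) (divisors n) (\<Pi>\<^sub>E p\<in>P. box (mexp n p))"
proof (rule bij_betw_subset[OF bij_betw_enc[OF P]])
  show "divisors n \<subseteq> smooth P" using divisors_smooth[OF n] by auto
  show "enc P ` divisors n = (\<Pi>\<^sub>E p\<in>P. box (mexp n p))"
  proof (intro equalityI subsetI)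
    fix \<phi> assume \<phi>: "\<phi> \<in> (\<Pi>\<^sub>E p\<in>P. box (mexp n p))"
    then have "\<phi> \<in> (P \<rightarrow>\<^sub>E exps)" using box_exps by (auto simp: PiE_iff)
    then obtain d where "d \<in> smooth P" "\<phi> = enc P d"
      using bij_betw_imp_surj_on[OF bij_betw_enc[OF P]] by blast
    then show "\<phi> \<in> enc P ` divisors n" using \<phi> enc_mem_box_iff[OF n] by auto
  qed (use enc_mem_box_iff[OF n] divisors_smooth[OF n] in auto)
qed

lemma F_zero: "F (\<lambda>i\<in>I. 0) = 1"
proof -
  obtain i where "i \<in> I" using I_nonempty by auto
  then show ?thesis using F_axis[of i "\<lambda>i\<in>I. 0"] by simp
qed

lemma G_zero: "G (\<lambda>i\<in>I. 0) = 1"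
proof -
  obtain i where "i \<in> I" using I_nonempty by auto
  then show ?thesis using G_axis[of "\<lambda>i\<in>I. 0" i] by (simp add: exps_def)
qed

text \<open>\<open>F_eq_conv_G\<close> holds at every prime of the support. Expanding the product of
  these local sums chooses one vector below \<open>mexp n p\<close> at each \<open>p\<close>;
  together the choices are a divisor tuple, and the factors recombine to \<open>euler G d\<close>
  and values of \<open>tau\<close>.\<close>

lemma euler_F_eq_conv:
  assumes "n \<in> tuples"
  shows "euler F n = (\<Sum>d\<in>divisors n. euler G d * (\<Prod>i\<in>I. real (tau (n i div d i))))"
proof -
  define P where "P = supp n"
  have P: "finite P" "\<And>p. p \<in> P \<Longrightarrow> prime p" by (auto simp: P_def prime_supp)
  have n: "n \<in> smooth P" using assms by (simp add: smooth_def P_def)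
  let ?t = "\<lambda>p \<kappa>. \<Prod>i\<in>I. real (Suc (mexp n p i - \<kappa> i))"
  have "euler F n = (\<Prod>p\<in>P. \<Sum>\<kappa>\<in>box (mexp n p). G \<kappa> * ?t p \<kappa>)"
    unfolding euler_def P_def[symmetric] by (intro prod.cong refl F_eq_conv_G) auto
  also have "\<dots> = (\<Sum>\<phi>\<in>(\<Pi>\<^sub>E p\<in>P. box (mexp n p)). \<Prod>p\<in>P. G (\<phi> p) * ?t p (\<phi> p))"
    using P by (subst prod_sum_PiE) auto
  also have "\<dots> = (\<Sum>d\<in>divisors n. \<Prod>p\<in>P. G (enc P d p) * ?t p (enc P d p))"
    by (rule sum.reindex_bij_betw[OF bij_betw_enc_divisors[OF P n], symmetric])
  also have "\<dots> = (\<Sum>d\<in>divisors n. euler G d * (\<Prod>i\<in>I. real (tau (n i div d i))))"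
  proof (rule sum.cong[OF refl])
    fix d assume d: "d \<in> divisors n"
    have ds: "d \<in> smooth P" using divisors_smooth[OF n d] .
    have "(\<Prod>i\<in>I. real (tau (n i div d i))) = (\<Prod>i\<in>I. \<Prod>p\<in>P. real (Suc (multiplicity p (n i) - multiplicity p (d i))))"
    proof (rule prod.cong[OF refl])
      fix i assume i: "i \<in> I"
      have *: "d i dvd n i" "n i > 0" using i d assms by (auto simp: divisors_def tuples_pos)
      have "prime_factors (n i div d i) \<subseteq> prime_factors (n i)"
        using * by (intro dvd_prime_factors) auto
      also have "\<dots> \<subseteq> P" using n i supp_subset_iff[of n] by (auto simp: smooth_def)
      finally have "tau (n i div d i) = (\<Prod>p\<in>P. Suc (multiplicity p (n i div d i)))"
        using * P by (intro tau_eq_prod) (auto simp: dvd_div_eq_0_iff intro!: Nat.gr0I)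
      also have "\<dots> = (\<Prod>p\<in>P. Suc (multiplicity p (n i) - multiplicity p (d i)))"
        using * P by (intro prod.cong) (auto simp: multiplicity_div)
      finally show "real (tau (n i div d i)) = (\<Prod>p\<in>P. real (Suc (multiplicity p (n i) - multiplicity p (d i))))"
        by simp
    qed
    also have "\<dots> = (\<Prod>p\<in>P. ?t p (enc P d p))"
      by (subst prod.swap) (auto simp: enc_def mexp_def intro!: prod.cong)
    finally show "(\<Prod>p\<in>P. G (enc P d p) * ?t p (enc P d p)) = euler G d * (\<Prod>i\<in>I. real (tau (n i div d i)))"
      using euler_eq[OF ds P, of G] G_zero by (simp add: prod.distrib enc_def)
  qed
  finally show ?thesis .
qed

end

section \<open>Absolute convergence and the Euler product\<close>

text \<open>A finite set \<open>X\<close> carries all but \<open>e / 2\<close> of the sum of norms,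
  and \<open>S n\<close> eventually contains it. What \<open>S n\<close> misses is then bounded by
  the sum of norms outside \<open>X\<close>.\<close>

lemma infsum_incseq_tendsto:
  fixes f :: "'a \<Rightarrow> real"
  assumes f: "f abs_summable_on A" and S: "incseq S" "(\<Union>n. S n) = A"
  shows "(\<lambda>n. infsum f (S n)) \<longlonglongrightarrow> infsum f A"
proof (rule LIMSEQ_I)
  fix e :: real assume "e > 0"
  have SA: "S n \<subseteq> A" for n using S by auto
  obtain X where X: "finite X" "X \<subseteq> A" "dist (\<Sum>x\<in>X. norm (f x)) (infsum (\<lambda>x. norm (f x)) A) \<le> e / 2"
    using infsum_finite_approximation[OF f, of "e / 2"] \<open>e > 0\<close> by auto
  have "\<forall>x\<in>X. \<exists>n. x \<in> S n" using X S by blast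
  then obtain k where k: "\<And>x. x \<in> X \<Longrightarrow> x \<in> S (k x)" by metis
  define N where "N = Max (insert 0 (k ` X))"
  have "norm (infsum f (S n) - infsum f A) < e" if "n \<ge> N" for n
  proof -
    have "X \<subseteq> S n"
    proof
      fix x assume x: "x \<in> X"
      then have "k x \<le> n" using that X(1) by (simp add: N_def)
      then show "x \<in> S n" using k[OF x] S(1) by (auto simp: incseq_def)
    qed
    have sub: "f summable_on B" "(\<lambda>x. norm (f x)) summable_on B" if "B \<subseteq> A" for B
      using summable_on_subset_banach[OF f that] abs_summable_summable[of f B] by auto
    have "infsum f A - infsum f (S n) = infsum f (A - S n)"
      using sub SA by (simp add: infsum_Diff)
    then have "norm (infsum f (S n) - infsum f A) = norm (infsum f (A - S n))"
      by (simp add: norm_minus_commute)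
    also have "\<dots> \<le> infsum (\<lambda>x. norm (f x)) (A - S n)"
      by (intro norm_infsum_bound sub) auto
    also have "\<dots> \<le> infsum (\<lambda>x. norm (f x)) (A - X)"
      using \<open>X \<subseteq> S n\<close> by (intro infsum_mono2 sub) auto
    also have "\<dots> = infsum (\<lambda>x. norm (f x)) A - (\<Sum>x\<in>X. norm (f x))"
      using X sub by (subst infsum_Diff) auto
    also have "\<dots> \<le> e / 2" using X(3) by (simp only: dist_real_def abs_le_iff) linarith
    finally show ?thesis using \<open>e > 0\<close> by simp
  qed
  then show "\<exists>N. \<forall>n\<ge>N. norm (infsum f (S n) - infsum f A) < e" by blast
qed

context local_factor
begin

text \<open>
  \<open>lwt a p\<close> is the local factor of \<open>wt a\<close> at \<open>p\<close>. The conditions in \<open>admissible\<close> make every exponent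
  vector with two nonzero entries contribute at most \<open>O(p powr (- 5/4))\<close> to the local sum at \<open>p\<close>.
\<close>

definition wt :: "('a \<Rightarrow> real) \<Rightarrow> ('a \<Rightarrow> nat) \<Rightarrow> real" where
  "wt a d = (\<Prod>i\<in>I. real (d i) powr - a i)"

definition lwt :: "('a \<Rightarrow> real) \<Rightarrow> nat \<Rightarrow> ('a \<Rightarrow> nat) \<Rightarrow> real" where
  "lwt a p \<kappa> = (\<Prod>i\<in>I. (real p powr - a i) ^ \<kappa> i)"

definition admissible :: "('a \<Rightarrow> real) \<Rightarrow> bool" where
  "admissible a \<longleftrightarrow> (\<forall>i\<in>I. a i \<ge> 1/4) \<and> (\<forall>i\<in>I. \<forall>k\<in>I. i \<noteq> k \<longrightarrow> a i + a k \<ge> 5/4)"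

lemma lwt_nonneg [simp]: "lwt a p \<kappa> \<ge> 0"
  by (auto simp: lwt_def intro!: prod_nonneg)

lemma lwt_eq:
  assumes "p > 0"
  shows "lwt a p \<kappa> = real p powr - (\<Sum>i\<in>I. a i * real (\<kappa> i))"
proof -
  have "lwt a p \<kappa> = (\<Prod>i\<in>I. real p powr - (a i * real (\<kappa> i)))"
    unfolding lwt_def by (intro prod.cong refl) (simp add: powr_powr assms flip: powr_realpow)
  then show ?thesis using assms by (simp add: powr_sum flip: sum_negf)
qed

lemma lwt_one:
  assumes "p > 0"
  shows "lwt (\<lambda>_. 1) p \<kappa> = (1 / real p) ^ (\<Sum>i\<in>I. \<kappa> i)"
  using assms by (simp add: lwt_def powr_minus_divide power_sum)

section \<open>Sums over tuples with primes from a finite set\<close>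

lemma wt_smooth:
  assumes P: "finite P" "\<And>p. p \<in> P \<Longrightarrow> prime p" and d: "d \<in> smooth P"
  shows "wt a d = (\<Prod>p\<in>P. lwt a p (enc P d p))"
proof -
  have "real (d i) powr - a i = (\<Prod>p\<in>P. (real p powr - a i) ^ multiplicity p (d i))" if i: "i \<in> I" for i
  proof -
    have "d i \<noteq> 0" and sub: "prime_factors (d i) \<subseteq> P"
      using d i supp_subset_iff[of d] tuples_pos[of d i] by (auto simp: smooth_def)
    then have "d i = (\<Prod>p\<in>prime_factors (d i). p ^ multiplicity p (d i))"
      using prod_prime_factors[of "d i"] by simp
    also have "\<dots> = (\<Prod>p\<in>P. p ^ multiplicity p (d i))"
      using P sub by (intro prod.mono_neutral_left) (auto simp: prime_factors_multiplicity)
    finally have "real (d i) = (\<Prod>p\<in>P. real p ^ multiplicity p (d i))"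
      by (metis (no_types, lifting) of_nat_power of_nat_prod prod.cong)
    then have "real (d i) powr - a i = (\<Prod>p\<in>P. (real p ^ multiplicity p (d i)) powr - a i)"
      by (simp add: prod_powr_distrib)
    also have "\<dots> = (\<Prod>p\<in>P. (real p powr - a i) ^ multiplicity p (d i))"
    proof (intro prod.cong refl)
      fix p assume "p \<in> P"
      then have "real p > 0" using P prime_gt_0_nat by auto
      then show "(real p ^ multiplicity p (d i)) powr - a i = (real p powr - a i) ^ multiplicity p (d i)"
        by (simp add: powr_powr mult.commute flip: powr_realpow)
    qed
    finally show ?thesis .
  qed
  then have "wt a d = (\<Prod>i\<in>I. \<Prod>p\<in>P. (real p powr - a i) ^ multiplicity p (d i))"
    unfolding wt_def by (intro prod.cong refl)
  also have "\<dots> = (\<Prod>p\<in>P. \<Prod>i\<in>I. (real p powr - a i) ^ multiplicity p (d i))"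
    by (rule prod.swap)
  also have "\<dots> = (\<Prod>p\<in>P. lwt a p (enc P d p))"
    by (intro prod.cong refl) (auto simp: lwt_def enc_def mexp_def)
  finally show ?thesis .
qed

text \<open>Through \<open>enc\<close> the summand becomes a product over \<open>P\<close> of
  functions of independent vectors, so the sum is the product of the local sums. \<open>H\<close> is
  general because \<open>\<bar>G\<bar>\<close> serves for convergence and \<open>G\<close> for the
  value of the Euler product.\<close>

lemma smooth_sum:
  assumes P: "finite P" "\<And>p. p \<in> P \<Longrightarrow> prime p" and H: "H (\<lambda>i\<in>I. 0) = 1"
    and s: "\<And>p. p \<in> P \<Longrightarrow> (\<lambda>\<kappa>. H \<kappa> * lwt a p \<kappa>) abs_summable_on exps"
  shows "(\<lambda>d. euler H d * wt a d) abs_summable_on smooth P"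
    and "infsum (\<lambda>d. euler H d * wt a d) (smooth P) = (\<Prod>p\<in>P. infsum (\<lambda>\<kappa>. H \<kappa> * lwt a p \<kappa>) exps)"
proof -
  have eq: "euler H d * wt a d = (\<Prod>p\<in>P. H (enc P d p) * lwt a p (enc P d p))" if "d \<in> smooth P" for d
    using euler_eq[where H = H, OF that P H] wt_smooth[where a = a, OF P that]
    by (simp add: enc_def prod.distrib)
  let ?g = "\<lambda>\<phi>. \<Prod>p\<in>P. H (\<phi> p) * lwt a p (\<phi> p)"
  have "?g abs_summable_on (P \<rightarrow>\<^sub>E exps)"
    by (intro abs_summable_on_prod_PiE P s)
  then have "(\<lambda>d. norm (?g (enc P d))) summable_on smooth P"
    using summable_on_reindex_bij_betw[OF bij_betw_enc[OF P], of "\<lambda>\<phi>. norm (?g \<phi>)"] by simp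
  then show "(\<lambda>d. euler H d * wt a d) abs_summable_on smooth P"
    by (rule summable_on_cong[THEN iffD1, rotated]) (simp add: eq)
  have "infsum (\<lambda>d. euler H d * wt a d) (smooth P) = infsum (\<lambda>d. ?g (enc P d)) (smooth P)"
    by (intro infsum_cong eq)
  also have "\<dots> = infsum ?g (P \<rightarrow>\<^sub>E exps)"
    by (intro infsum_reindex_bij_betw bij_betw_enc P)
  also have "\<dots> = (\<Prod>p\<in>P. infsum (\<lambda>\<kappa>. H \<kappa> * lwt a p \<kappa>) exps)"
    by (intro infsum_prod_PiE_abs P s)
  finally show "infsum (\<lambda>d. euler H d * wt a d) (smooth P) = (\<Prod>p\<in>P. infsum (\<lambda>\<kappa>. H \<kappa> * lwt a p \<kappa>) exps)" .
qed

text \<open>Independent of the prime: \<open>2 powr (- 1/4)\<close> bounds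
  \<open>p powr (- 1/4)\<close> for all \<open>p \<ge> 2\<close>, and \<open>2 powr (1/2)\<close>
  compensates for the two powers that \<open>abs_G_lwt_le\<close> spends on
  \<open>p powr (- 5/4)\<close>.\<close>

definition G_bound :: real where
  "G_bound = infsum (\<lambda>\<kappa>. 2 powr (1/2) * \<bar>G \<kappa> * (2 powr (- 1/4)) ^ (\<Sum>i\<in>I. \<kappa> i)\<bar>) exps"

lemma summable_G_bound:
  "(\<lambda>\<kappa>. 2 powr (1/2) * \<bar>G \<kappa> * (2 powr (- 1/4)) ^ (\<Sum>i\<in>I. \<kappa> i)\<bar>) summable_on exps"
proof -
  have "2 powr (- 1/4) < (2 powr 0 :: real)"
    by (intro powr_less_mono) auto
  then show ?thesis
    using abs_summable_G_power[of "2 powr (- 1/4)"] by (intro summable_on_cmult_right) auto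
qed

lemma G_bound_nonneg: "G_bound \<ge> 0"
  unfolding G_bound_def by (intro infsum_nonneg) auto

text \<open>If \<open>G \<kappa> \<noteq> 0\<close>, the vector lies off the axes and has two
  nonzero entries \<open>i\<close> and \<open>k\<close>. One power from each gives the exponent
  \<open>a i + a k \<ge> 5/4\<close>; each of the remaining powers has exponent at least 1/4, and
  there \<open>p\<close> may be lowered to 2.\<close>

lemma abs_G_lwt_le:
  assumes a: "admissible a" and p: "p \<ge> 2" and \<kappa>: "\<kappa> \<in> exps" "\<kappa> \<noteq> (\<lambda>i\<in>I. 0)"
  shows "\<bar>G \<kappa>\<bar> * lwt a p \<kappa> \<le>
    real p powr (- 5/4) * (2 powr (1/2) * \<bar>G \<kappa> * (2 powr (- 1/4)) ^ (\<Sum>i\<in>I. \<kappa> i)\<bar>)"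
proof (cases "G \<kappa> = 0")
  case False
  obtain i where i: "i \<in> I" "\<kappa> i \<noteq> 0"
  proof (rule ccontr)
    assume "\<not> thesis"
    then have "\<forall>i\<in>I. \<kappa> i = 0" using that by blast
    then have "\<kappa> = (\<lambda>i\<in>I. 0)" using \<kappa>(1) by (auto simp: exps_def intro: PiE_ext)
    then show False using \<kappa>(2) by simp
  qed
  obtain k where k: "k \<in> I" "k \<noteq> i" "\<kappa> k \<noteq> 0"
  proof (rule ccontr)
    assume "\<not> thesis"
    then have "\<And>j. j \<in> I - {i} \<Longrightarrow> \<kappa> j = 0" using that by blast
    then have "G \<kappa> = 0" using G_axis[OF \<kappa>(1) i(1)] i(2) by simp
    then show False using False by simp
  qed
  let ?n = "real (\<Sum>i\<in>I. \<kappa> i)"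
  have "(\<Sum>j\<in>I - {i,k}. (1/4) * real (\<kappa> j)) \<le> (\<Sum>j\<in>I - {i,k}. a j * real (\<kappa> j))"
    using a by (intro sum_mono mult_right_mono) (auto simp: admissible_def)
  moreover have "a i * real (\<kappa> i) \<ge> a i + (1/4) * (real (\<kappa> i) - 1)"
  proof -
    have "(a i - 1/4) * (real (\<kappa> i) - 1) \<ge> 0" using a i by (intro mult_nonneg_nonneg) (auto simp: admissible_def)
    then show ?thesis by (simp add: algebra_simps)
  qed
  moreover have "a k * real (\<kappa> k) \<ge> a k + (1/4) * (real (\<kappa> k) - 1)"
  proof -
    have "(a k - 1/4) * (real (\<kappa> k) - 1) \<ge> 0" using a k by (intro mult_nonneg_nonneg) (auto simp: admissible_def)
    then show ?thesis by (simp add: algebra_simps)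
  qed
  moreover have "a i + a k \<ge> 5/4" using a i k by (auto simp: admissible_def)
  moreover have dec: "(\<Sum>j\<in>I. f j) = f i + (f k + (\<Sum>j\<in>I - {i,k}. f j))" for f :: "'a \<Rightarrow> real"
  proof -
    have "I - {i} - {k} = I - {i, k}" by auto
    then show ?thesis
      using finite_I i k by (simp add: sum.remove[of I i] sum.remove[of "I - {i}" k])
  qed
  ultimately have ge: "(\<Sum>j\<in>I. a j * real (\<kappa> j)) \<ge> 5/4 + (?n - 2) / 4"
    unfolding of_nat_sum dec[of "\<lambda>j. a j * real (\<kappa> j)"] dec[of "\<lambda>j. real (\<kappa> j)"] sum_distrib_left[symmetric]
    by argo
  have n2: "?n \<ge> 2"
  proof -
    have "(\<Sum>j\<in>{i,k}. \<kappa> j) \<le> (\<Sum>j\<in>I. \<kappa> j)" using finite_I i k by (intro sum_mono2) auto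
    then have "2 \<le> (\<Sum>j\<in>I. \<kappa> j)" using i k by simp
    then show ?thesis by linarith
  qed
  have "lwt a p \<kappa> \<le> real p powr (- (5/4 + (?n - 2) / 4))"
    using ge p by (subst lwt_eq) (auto intro!: powr_mono)
  also have "\<dots> = real p powr (- 5/4) * real p powr (- ((?n - 2) / 4))"
    by (simp flip: powr_add)
  also have "\<dots> \<le> real p powr (- 5/4) * 2 powr (- ((?n - 2) / 4))"
    using p n2 by (intro mult_left_mono powr_mono2') auto
  also have "2 powr (- ((?n - 2) / 4)) = (2 powr (1/2) * (2 powr (- 1/4)) ^ (\<Sum>i\<in>I. \<kappa> i) :: real)"
  proof -
    have "- ((?n - 2) / 4) = 1/2 + (- 1/4) * ?n" by (simp add: field_simps)
    moreover have "((2 powr (- 1/4)) ^ (\<Sum>i\<in>I. \<kappa> i) :: real) = 2 powr ((- 1/4) * ?n)"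
      by (subst powr_power) (auto simp: mult.commute)
    ultimately show ?thesis by (simp only: powr_add)
  qed
  finally have "\<bar>G \<kappa>\<bar> * lwt a p \<kappa> \<le> \<bar>G \<kappa>\<bar> * (real p powr (- 5/4) * (2 powr (1/2) * (2 powr (- 1/4)) ^ (\<Sum>i\<in>I. \<kappa> i)))"
    by (intro mult_left_mono) auto
  then show ?thesis by (simp add: abs_mult mult_ac)
qed auto

text \<open>The zero vector contributes exactly 1; all other terms are bounded by
  \<open>abs_G_lwt_le\<close>, whose right-hand sides sum to at most the stated error.\<close>

lemma local_G_sum:
  assumes a: "admissible a" and p: "p \<ge> 2"
  shows "(\<lambda>\<kappa>. G \<kappa> * lwt a p \<kappa>) abs_summable_on exps"
    and "\<bar>infsum (\<lambda>\<kappa>. G \<kappa> * lwt a p \<kappa>) exps - 1\<bar> \<le> G_bound * real p powr (- 5/4)"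
    and "infsum (\<lambda>\<kappa>. \<bar>G \<kappa>\<bar> * lwt a p \<kappa>) exps \<le> 1 + G_bound * real p powr (- 5/4)"
proof -
  let ?z = "\<lambda>i\<in>I. 0 :: nat" and ?f = "\<lambda>\<kappa>. G \<kappa> * lwt a p \<kappa>"
  let ?b = "\<lambda>\<kappa>. real p powr (- 5/4) * (2 powr (1/2) * \<bar>G \<kappa> * (2 powr (- 1/4)) ^ (\<Sum>i\<in>I. \<kappa> i)\<bar>)"
  have z: "?z \<in> exps" by (simp add: exps_def)
  have ins: "exps = insert ?z (exps - {?z})" using z by auto
  have b: "?b summable_on exps"
    by (intro summable_on_cmult_right summable_G_bound)
  have b': "?b summable_on (exps - {?z})"
    by (rule summable_on_subset_banach[OF b]) auto
  have le: "norm (?f \<kappa>) \<le> ?b \<kappa>" if "\<kappa> \<in> exps - {?z}" for \<kappa>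
    using abs_G_lwt_le[OF a p, of \<kappa>] that by (simp add: abs_mult)
  have f': "?f abs_summable_on (exps - {?z})"
    by (rule Infinite_Sum.abs_summable_on_comparison_test'[OF b' le])
  then show f: "?f abs_summable_on exps"
    using summable_on_insert_iff[of "\<lambda>\<kappa>. norm (?f \<kappa>)" ?z "exps - {?z}"] ins by simp
  have fz: "?f ?z = 1" by (simp add: G_zero lwt_def)
  have "infsum (\<lambda>\<kappa>. norm (?f \<kappa>)) (exps - {?z}) \<le> infsum ?b (exps - {?z})"
    using f' b' le by (intro infsum_mono) auto
  also have "\<dots> \<le> infsum ?b exps"
    by (intro infsum_mono2 b b') auto
  also have "\<dots> = G_bound * real p powr (- 5/4)"
    unfolding G_bound_def by (simp add: infsum_cmult_right')
  finally have bd: "infsum (\<lambda>\<kappa>. norm (?f \<kappa>)) (exps - {?z}) \<le> G_bound * real p powr (- 5/4)" .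
  have "infsum ?f exps = 1 + infsum ?f (exps - {?z})"
    using infsum_insert[of ?f "exps - {?z}" ?z] abs_summable_summable[OF f'] ins fz by simp
  then show "\<bar>infsum ?f exps - 1\<bar> \<le> G_bound * real p powr (- 5/4)"
    using norm_infsum_bound[OF f'] bd by simp
  have "infsum (\<lambda>\<kappa>. norm (?f \<kappa>)) exps = 1 + infsum (\<lambda>\<kappa>. norm (?f \<kappa>)) (exps - {?z})"
    using infsum_insert[of "\<lambda>\<kappa>. norm (?f \<kappa>)" "exps - {?z}" ?z] f' ins fz by simp
  then show "infsum (\<lambda>\<kappa>. \<bar>G \<kappa>\<bar> * lwt a p \<kappa>) exps \<le> 1 + G_bound * real p powr (- 5/4)"
    using bd by (simp add: abs_mult)
qed

text \<open>Any finite set of tuples lies in \<open>smooth P\<close> for a finite set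
  \<open>P\<close> of primes, where the sum of absolute values is an Euler product. Its factors are
  1 + O(p^(-5/4)), so 1 + u <= exp u and the convergence of the sum of n^(-5/4) give a bound
  independent of \<open>P\<close>.\<close>

lemma abs_summable_euler_G:
  assumes a: "admissible a"
  shows "(\<lambda>d. euler G d * wt a d) abs_summable_on tuples"
  unfolding abs_summable_iff_bdd_above
proof (rule bdd_aboveI2)
  let ?Z = "\<Sum>n. real n powr (- 5/4)"
  have Z: "summable (\<lambda>n. real n powr (- 5/4))" by (simp add: summable_real_powr_iff)
  fix S assume "S \<in> {F. F \<subseteq> tuples \<and> finite F}"
  then have S: "S \<subseteq> tuples" "finite S" by auto
  define P where "P = (\<Union>d\<in>S. supp d)"
  have P: "finite P" "\<And>p. p \<in> P \<Longrightarrow> prime p" using S by (auto simp: P_def prime_supp)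
  have SP: "S \<subseteq> smooth P" using S by (auto simp: smooth_def P_def)
  \<comment> \<open>The absolute value of \<open>euler G\<close> is \<open>euler\<close> of
    \<open>\<bar>G\<bar>\<close>, so absolute convergence is again a question about local
    sums.\<close>
  let ?H = "\<lambda>\<kappa>. \<bar>G \<kappa>\<bar>"
  have H: "(\<lambda>\<kappa>. ?H \<kappa> * lwt a p \<kappa>) abs_summable_on exps" if "p \<in> P" for p
    using local_G_sum(1)[OF a, of p] prime_ge_2_nat[OF P(2)[OF that]] by (simp add: abs_mult)
  note sm = smooth_sum[of P ?H a, OF P _ H]
  have wt: "wt a d \<ge> 0" for d by (auto simp: wt_def intro!: prod_nonneg)
  have abs: "norm (euler G d * wt a d) = euler ?H d * wt a d" for d
    using wt[of d] by (simp add: abs_mult euler_def abs_prod)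
  have "(\<Sum>d\<in>S. norm (euler G d * wt a d)) = (\<Sum>d\<in>S. euler ?H d * wt a d)"
    by (simp only: abs)
  also have "\<dots> \<le> infsum (\<lambda>d. euler ?H d * wt a d) (smooth P)"
    using SP S wt G_zero
    by (intro finite_sum_le_infsum abs_summable_summable[OF sm(1)])
       (auto simp: euler_def intro!: mult_nonneg_nonneg prod_nonneg)
  also have "\<dots> = (\<Prod>p\<in>P. infsum (\<lambda>\<kappa>. ?H \<kappa> * lwt a p \<kappa>) exps)"
    using sm(2) G_zero by simp
  also have "\<dots> \<le> (\<Prod>p\<in>P. 1 + G_bound * real p powr (- 5/4))"
    using local_G_sum(3)[OF a] prime_ge_2_nat[OF P(2)]
    by (intro prod_mono conjI infsum_nonneg) auto
  also have "\<dots> \<le> exp (\<Sum>p\<in>P. G_bound * real p powr (- 5/4))"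
    using G_bound_nonneg by (intro prod_le_exp_sum) auto
  also have "\<dots> \<le> exp (G_bound * ?Z)"
    using Z P G_bound_nonneg by (auto simp flip: sum_distrib_left intro!: mult_left_mono sum_le_suminf)
  finally show "(\<Sum>d\<in>S. norm (euler G d * wt a d)) \<le> exp (G_bound * ?Z)" .
qed

section \<open>The leading constant and its Euler product\<close>

lemma admissible_one: "admissible (\<lambda>_. 1)"
  by (simp add: admissible_def)

definition K :: real where "K = infsum (\<lambda>d. euler G d * wt (\<lambda>_. 1) d) tuples"

text \<open>Written with \<open>F\<close> to match the shape of the target factors; by
  \<open>infsum_G_power\<close> it is the local sum of \<open>G\<close> at a prime.\<close>

definition K_factor :: "nat \<Rightarrow> real" where
  "K_factor p = (1 - 1 / real p) ^ (2 * card I) * infsum (\<lambda>\<nu>. F \<nu> * (1 / real p) ^ (\<Sum>i\<in>I. \<nu> i)) exps"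

lemma K_factor_eq:
  assumes "prime p"
  shows "K_factor p = infsum (\<lambda>\<kappa>. G \<kappa> * lwt (\<lambda>_. 1) p \<kappa>) exps"
proof -
  have "p \<ge> 2" using assms by (rule prime_ge_2_nat)
  then show ?thesis
    using infsum_G_power[of "1 / real p"] by (simp add: K_factor_def lwt_one)
qed

text \<open>The zero vector alone contributes 1 to the series, and no term is negative. This later
  excludes a vanishing product.\<close>

lemma K_factor_pos:
  assumes "prime p"
  shows "K_factor p > 0"
proof -
  have p: "p \<ge> 2" using assms by (rule prime_ge_2_nat)
  let ?f = "\<lambda>\<nu>. F \<nu> * (1 / real p) ^ (\<Sum>i\<in>I. \<nu> i)"
  have "(\<Sum>\<nu>\<in>{\<lambda>i\<in>I. 0}. ?f \<nu>) \<le> infsum ?f exps"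
    using p F_nonneg
    by (intro finite_sum_le_infsum abs_summable_summable[OF abs_summable_F_power]) (auto simp: exps_def PiE_iff)
  then have "infsum ?f exps > 0" by (simp add: F_zero)
  then show ?thesis using p unfolding K_factor_def by (intro mult_pos_pos zero_less_power) auto
qed

text \<open>The factors differ from 1 by O(p^(-5/4)), so the product converges. Its value comes from
  the tuples with all primes up to \<open>N\<close>: their sum is a finite Euler product and tends
  to \<open>K\<close>. A convergent product of nonzero factors is nonzero.\<close>

lemma has_prime_prod_K: "has_prime_prod K_factor K" and K_nonzero: "K \<noteq> 0"
proof -
  let ?f = "\<lambda>p. if prime p then K_factor p else 1"
  have "summable (\<lambda>p. norm (?f p - 1))"
  proof (rule summable_comparison_test)
    show "summable (\<lambda>n. G_bound * real n powr (- 5/4))"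
      by (intro summable_mult) (simp add: summable_real_powr_iff)
    show "\<exists>N. \<forall>n\<ge>N. norm (norm (?f n - 1)) \<le> G_bound * real n powr (- 5/4)"
      using local_G_sum(2)[OF admissible_one] G_bound_nonneg
      by (auto simp: K_factor_eq prime_ge_2_nat)
  qed
  then have conv: "convergent_prod ?f"
    by (intro abs_convergent_prod_imp_convergent_prod summable_imp_abs_convergent_prod)
  define P where "P N = {p. prime p \<and> p \<le> N}" for N :: nat
  have P: "finite (P N)" "\<And>p. p \<in> P N \<Longrightarrow> prime p" for N
    by (auto simp: P_def)
  have "(\<lambda>N. infsum (\<lambda>d. euler G d * wt (\<lambda>_. 1) d) (smooth (P N))) \<longlonglongrightarrow> K"
    unfolding K_def
  proof (rule infsum_incseq_tendsto)
    show "(\<lambda>d. euler G d * wt (\<lambda>_. 1) d) abs_summable_on tuples"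
      by (rule abs_summable_euler_G[OF admissible_one])
    show "incseq (\<lambda>N. smooth (P N))"
      by (auto simp: incseq_def smooth_def P_def subset_iff)
    show "(\<Union>N. smooth (P N)) = tuples"
    proof (intro equalityI subsetI)
      fix d assume "d \<in> tuples"
      \<comment> \<open>The 0 covers the tuple of ones, whose support is empty.\<close>
      moreover have "supp d \<subseteq> P (Max (insert 0 (supp d)))"
        by (auto simp: P_def prime_supp)
      ultimately show "d \<in> (\<Union>N. smooth (P N))" by (auto simp: smooth_def)
    qed (auto simp: smooth_def)
  qed
  moreover have "infsum (\<lambda>d. euler G d * wt (\<lambda>_. 1) d) (smooth (P N)) = (\<Prod>p\<le>N. ?f p)" for N
  proof -
    have "infsum (\<lambda>d. euler G d * wt (\<lambda>_. 1) d) (smooth (P N))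
        = (\<Prod>p\<in>P N. infsum (\<lambda>\<kappa>. G \<kappa> * lwt (\<lambda>_. 1) p \<kappa>) exps)"
      by (intro smooth_sum P G_zero local_G_sum admissible_one) (use P prime_ge_2_nat in auto)
    also have "\<dots> = (\<Prod>p\<in>P N. ?f p)"
      by (intro prod.cong) (auto simp: P_def K_factor_eq)
    also have "\<dots> = (\<Prod>p\<le>N. ?f p)"
      by (intro prod.mono_neutral_left) (auto simp: P_def)
    finally show ?thesis .
  qed
  ultimately have "(\<lambda>N. \<Prod>p\<le>N. ?f p) \<longlonglongrightarrow> K" by simp
  then have "prodinf ?f = K"
    using convergent_prod_LIMSEQ[OF conv] LIMSEQ_unique by blast
  then show "has_prime_prod K_factor K"
    unfolding has_prime_prod_def using conv by (auto simp: has_prod_iff)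
  have "prodinf ?f \<noteq> 0"
  proof (rule prodinf_nonzero[OF conv])
    show "?f p \<noteq> 0" for p using K_factor_pos[of p] by auto
  qed
  then show "K \<noteq> 0" using \<open>prodinf ?f = K\<close> by simp
qed

end

section \<open>The asymptotic formula\<close>

text \<open>Telescoping: \<open>f\<close> is exchanged for \<open>g\<close> one factor at a time.
  The common majorant \<open>m\<close> bounds the untouched factors, whichever of the two families
  they belong to.\<close>

lemma abs_prod_diff_le:
  fixes f g m :: "'a \<Rightarrow> real"
  assumes "finite A" "\<And>i. i \<in> A \<Longrightarrow> \<bar>f i\<bar> \<le> m i" "\<And>i. i \<in> A \<Longrightarrow> \<bar>g i\<bar> \<le> m i"
  shows "\<bar>(\<Prod>i\<in>A. f i) - (\<Prod>i\<in>A. g i)\<bar> \<le> (\<Sum>j\<in>A. \<bar>f j - g j\<bar> * (\<Prod>i\<in>A - {j}. m i))"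
  using assms
proof (induction A rule: finite_induct)
  case (insert x A)
  have m: "m i \<ge> 0" if "i \<in> insert x A" for i
    using insert.prems(1)[OF that] by linarith
  have IH: "\<bar>prod f A - prod g A\<bar> \<le> (\<Sum>j\<in>A. \<bar>f j - g j\<bar> * (\<Prod>i\<in>A - {j}. m i))"
    using insert by auto
  have ff: "\<bar>prod f A\<bar> \<le> prod m A"
    unfolding abs_prod using insert.prems by (intro prod_mono) auto
  have "\<bar>prod f (insert x A) - prod g (insert x A)\<bar> = \<bar>(f x - g x) * prod f A + g x * (prod f A - prod g A)\<bar>"
    using insert.hyps by (simp add: algebra_simps)
  also have "\<dots> \<le> \<bar>f x - g x\<bar> * prod m A + m x * (\<Sum>j\<in>A. \<bar>f j - g j\<bar> * (\<Prod>i\<in>A - {j}. m i))"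
    using insert.prems m ff IH
    by (intro order_trans[OF abs_triangle_ineq] add_mono) (auto simp: abs_mult intro!: mult_mono)
  also have "m x * (\<Sum>j\<in>A. \<bar>f j - g j\<bar> * (\<Prod>i\<in>A - {j}. m i))
      = (\<Sum>j\<in>A. \<bar>f j - g j\<bar> * (\<Prod>i\<in>insert x A - {j}. m i))"
    unfolding sum_distrib_left
  proof (intro sum.cong refl)
    fix j assume "j \<in> A"
    then have "insert x A - {j} = insert x (A - {j})" using insert.hyps by auto
    then show "m x * (\<bar>f j - g j\<bar> * (\<Prod>i\<in>A - {j}. m i)) = \<bar>f j - g j\<bar> * (\<Prod>i\<in>insert x A - {j}. m i)"
      using insert.hyps by simp
  qed
  also have "\<bar>f x - g x\<bar> * prod m A + \<dots> = (\<Sum>j\<in>insert x A. \<bar>f j - g j\<bar> * (\<Prod>i\<in>insert x A - {j}. m i))"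
    using insert.hyps by simp
  finally show ?case .
qed simp

section \<open>Bounds for the divisor sum and its main term\<close>

lemma finite_pos_upto [simp, intro]: "finite (pos_upto x)"
proof (rule finite_subset)
  show "pos_upto x \<subseteq> {..nat \<lfloor>x\<rfloor>}" by (auto simp: pos_upto_def le_nat_floor)
qed simp

lemma pos_upto_empty: "x < 1 \<Longrightarrow> pos_upto x = {}"
  by (auto simp: pos_upto_def)

definition tau_sum :: "real \<Rightarrow> real" where
  "tau_sum y = (\<Sum>n\<in>pos_upto y. real (tau n))"

definition tau_main :: "real \<Rightarrow> real" where
  "tau_main y = y * (ln y + (2 * euler_mascheroni - 1))"

lemma tau_sum_nonneg: "tau_sum y \<ge> 0"
  by (auto simp: tau_sum_def intro!: sum_nonneg)

lemma tau_sum_mono: "x \<le> y \<Longrightarrow> tau_sum x \<le> tau_sum y"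
  unfolding tau_sum_def by (rule sum_mono2[OF finite_pos_upto]) (auto simp: pos_upto_def)

lemma tau_sum_eq_0: "y < 1 \<Longrightarrow> tau_sum y = 0"
  by (simp add: tau_sum_def pos_upto_empty)

text \<open>The argument \<open>x / d\<close> may be below 1 and its logarithm negative, so
  \<open>ln x\<close> and \<open>ln d\<close> are bounded separately, each by
  \<open>x powr s * d powr s / s\<close>. The logarithm thus costs \<open>s\<close> in both
  exponents.\<close>

lemma abs_tau_main_le:
  assumes "x \<ge> 1" "d \<ge> 1" "0 < s"
  shows "\<bar>tau_main (x / d)\<bar> \<le> (2 / s + \<bar>2 * euler_mascheroni - 1\<bar>) * (x powr (1 + s) * d powr - (1 - s))"
proof -
  let ?c = "2 * euler_mascheroni - 1 :: real"
  have ge1: "x powr s \<ge> 1" "d powr s \<ge> 1"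
    using assms by (auto intro: ge_one_powr_ge_zero)
  have xs: "x powr s \<le> x powr s * d powr s" and ds: "d powr s \<le> x powr s * d powr s"
    and one: "1 \<le> x powr s * d powr s"
    using ge1 mult_mono[of 1 "x powr s" 1 "d powr s"] mult_left_mono[of 1 "d powr s" "x powr s"]
      mult_right_mono[of 1 "x powr s" "d powr s"] by auto
  have "ln x \<le> x powr s / s" "ln d \<le> d powr s / s"
    using assms by (auto intro!: ln_powr_bound)
  then have "ln x \<le> (x powr s * d powr s) / s" "ln d \<le> (x powr s * d powr s) / s"
    using xs ds assms(3) by (smt (verit) divide_right_mono)+
  moreover have "\<bar>?c\<bar> \<le> \<bar>?c\<bar> * (x powr s * d powr s)"
    using one by (simp add: mult_le_cancel_left1)
  moreover have "ln (x / d) = ln x - ln d" "ln x \<ge> 0" "ln d \<ge> 0"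
    using assms by (auto simp: ln_div)
  ultimately have "\<bar>ln (x / d) + ?c\<bar> \<le> (x powr s * d powr s) / s + (x powr s * d powr s) / s + \<bar>?c\<bar> * (x powr s * d powr s)"
    by linarith
  also have "\<dots> = (2 / s + \<bar>?c\<bar>) * (x powr s * d powr s)"
    by (simp add: algebra_simps)
  finally have "\<bar>tau_main (x / d)\<bar> \<le> (x / d) * ((2 / s + \<bar>?c\<bar>) * (x powr s * d powr s))"
    unfolding tau_main_def abs_mult using assms by (intro mult_mono) auto
  also have "\<dots> = (2 / s + \<bar>?c\<bar>) * (x powr (1 + s) * d powr - (1 - s))"
  proof -
    have "x powr (1 + s) = x * x powr s" using assms by (simp add: powr_add)
    moreover have "d powr - (1 - s) = d powr s / d"
      using assms powr_diff[of d s 1] by simp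
    ultimately show ?thesis by simp
  qed
  finally show ?thesis .
qed

text \<open>The arguments \<open>x / d\<close> range over all positive reals, so the estimate at
  infinity has to be extended downwards. Between 1 and \<open>y0\<close> everything is bounded;
  below 1 the divisor sum is empty and the main term is O(y^(3/4)), which is where
  \<open>\<beta> \<le> 3/4\<close> enters.\<close>

lemma abs_tau_error_le:
  assumes O: "(\<lambda>x. tau_sum x - tau_main x) \<in> O[at_top](\<lambda>x. x powr \<beta>)" and \<beta>: "0 \<le> \<beta>" "\<beta> \<le> 3/4"
  obtains C where "C \<ge> 0" "\<And>y. y > 0 \<Longrightarrow> \<bar>tau_sum y - tau_main y\<bar> \<le> C * y powr \<beta>"
proof -
  let ?c = "2 * euler_mascheroni - 1 :: real"
  obtain C1 where C1: "C1 > 0" "eventually (\<lambda>x. norm (tau_sum x - tau_main x) \<le> C1 * norm (x powr \<beta>)) at_top"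
    using O by (elim landau_o.bigE)
  then obtain y1 where y1: "\<And>y. y \<ge> y1 \<Longrightarrow> \<bar>tau_sum y - tau_main y\<bar> \<le> C1 * y powr \<beta>"
    by (auto simp: eventually_at_top_linorder)
  define y0 where "y0 = max y1 1"
  define C2 where "C2 = tau_sum y0 + y0 * (ln y0 + \<bar>?c\<bar>)"
  define C3 where "C3 = 4 + \<bar>?c\<bar>"
  have y0: "y0 \<ge> 1" by (simp add: y0_def)
  have C2: "C2 \<ge> 0" using y0 by (auto simp: C2_def intro!: add_nonneg_nonneg tau_sum_nonneg)
  have C3: "C3 \<ge> 0" by (simp add: C3_def)
  have "\<bar>tau_sum y - tau_main y\<bar> \<le> (C1 + C2 + C3) * y powr \<beta>" if y: "y > 0" for y
  proof -
    consider "y \<ge> y0" | "1 \<le> y" "y \<le> y0" | "y < 1" by linarith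
    then have "\<exists>C\<in>{C1, C2, C3}. \<bar>tau_sum y - tau_main y\<bar> \<le> C * y powr \<beta>"
    proof cases
      case 1
      then show ?thesis using y1[of y] by (auto simp: y0_def)
    next
      case 2
      have "\<bar>ln y + ?c\<bar> \<le> ln y0 + \<bar>?c\<bar>"
        using 2 ln_ge_zero[of y] by (smt (verit) ln_mono)
      then have "\<bar>tau_main y\<bar> \<le> y0 * (ln y0 + \<bar>?c\<bar>)"
        unfolding tau_main_def abs_mult using 2 by (intro mult_mono) auto
      moreover have "\<bar>tau_sum y\<bar> \<le> tau_sum y0"
        using tau_sum_mono[OF 2(2)] tau_sum_nonneg[of y] by simp
      ultimately have "\<bar>tau_sum y - tau_main y\<bar> \<le> C2 * 1" by (simp add: C2_def)
      also have "\<dots> \<le> C2 * y powr \<beta>"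
        using 2 \<beta> C2 by (intro mult_left_mono ge_one_powr_ge_zero) auto
      finally show ?thesis by blast
    next
      case 3
      have "ln (1 / y) \<le> (1 / y) powr (1/4) / (1/4)"
        using 3 y by (intro ln_powr_bound) auto
      then have "\<bar>ln y\<bar> \<le> 4 * y powr - (1/4)"
        using 3 y by (simp add: ln_div powr_divide powr_minus_divide)
      moreover have "\<bar>?c\<bar> \<le> \<bar>?c\<bar> * y powr - (1/4)"
        using 3 y powr_mono'[of "- (1/4)" 0 y] by (simp add: mult_le_cancel_left1)
      ultimately have "\<bar>ln y + ?c\<bar> \<le> C3 * y powr - (1/4)"
        unfolding C3_def distrib_right by linarith
      then have "\<bar>tau_main y\<bar> \<le> y * (C3 * y powr - (1/4))"
        unfolding tau_main_def abs_mult using y by (intro mult_mono) auto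
      also have "\<dots> = C3 * y powr (3/4)"
        using y powr_add[of y 1 "- (1/4)"] by simp
      also have "\<dots> \<le> C3 * y powr \<beta>"
        using 3 y \<beta> C3 by (intro mult_left_mono powr_mono') auto
      finally show ?thesis using tau_sum_eq_0[OF 3] by auto
    qed
    then obtain C where C: "C \<in> {C1, C2, C3}" "\<bar>tau_sum y - tau_main y\<bar> \<le> C * y powr \<beta>" by blast
    have "C * y powr \<beta> \<le> (C1 + C2 + C3) * y powr \<beta>"
      using C(1) C1(1) C2 C3 by (intro mult_right_mono) auto
    with C(2) show ?thesis by linarith
  qed
  then show thesis using that[of "C1 + C2 + C3"] C1(1) C2 C3 by simp
qed

text \<open>For \<open>x < d\<close> the sum is empty; otherwise the error
  \<open>(x / d) powr \<beta>\<close> is at most \<open>x / d\<close>. The constant dominates that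
  of \<open>abs_tau_main_le\<close>, so that one majorant serves both families in
  \<open>abs_prod_diff_le\<close>.\<close>

lemma tau_sum_le:
  assumes C: "C \<ge> 0" "\<And>y. y > 0 \<Longrightarrow> \<bar>tau_sum y - tau_main y\<bar> \<le> C * y powr \<beta>"
    and "\<beta> \<le> 1" "x \<ge> 1" "d \<ge> 1" "0 < s"
  shows "\<bar>tau_sum (x / d)\<bar> \<le> (C + (2 / s + \<bar>2 * euler_mascheroni - 1\<bar>)) * (x powr (1 + s) * d powr - (1 - s))"
proof (cases "x / d < 1")
  case True
  then show ?thesis using assms by (simp add: tau_sum_eq_0)
next
  case False
  let ?w = "x powr (1 + s) * d powr - (1 - s)"
  have "(x / d) powr \<beta> \<le> (x / d) powr 1" using False assms by (intro powr_mono) auto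
  also have "\<dots> = x powr 1 * d powr - 1" using assms by (simp add: powr_minus_divide)
  also have "\<dots> \<le> ?w" using assms by (intro mult_mono powr_mono) auto
  finally have "C * (x / d) powr \<beta> \<le> C * ?w" using C(1) by (intro mult_left_mono) auto
  moreover have "\<bar>tau_sum (x / d) - tau_main (x / d)\<bar> \<le> C * (x / d) powr \<beta>"
    using assms by (intro C(2)) auto
  ultimately show ?thesis
    using abs_tau_main_le[OF assms(4-6)] unfolding distrib_right by linarith
qed

lemma has_sum_sum:
  fixes f :: "'b \<Rightarrow> 'a \<Rightarrow> real"
  assumes "finite J" "\<And>j. j \<in> J \<Longrightarrow> (f j has_sum S j) A"
  shows "((\<lambda>x. \<Sum>j\<in>J. f j x) has_sum (\<Sum>j\<in>J. S j)) A"
  using assms by (induction J rule: finite_induct) (auto intro: has_sum_add)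

section \<open>From the sum over tuples to a polynomial in the logarithm\<close>

context local_factor
begin

text \<open>Substitute n_i = d_i m_i in \<open>euler_F_eq_conv\<close>. The conditions m_i <= x /
  d_i are independent of one another, so the inner sum factors.\<close>

lemma sum_euler_F_eq:
  "(\<Sum>n\<in>I \<rightarrow>\<^sub>E pos_upto x. euler F n) = (\<Sum>d\<in>I \<rightarrow>\<^sub>E pos_upto x. euler G d * (\<Prod>i\<in>I. tau_sum (x / real (d i))))"
proof -
  let ?N = "I \<rightarrow>\<^sub>E pos_upto x"
  let ?M = "\<lambda>d. \<Pi>\<^sub>E i\<in>I. pos_upto (x / real (d i))"
  have N: "finite ?N" using finite_I by (intro finite_PiE) auto
  have M: "finite (?M d)" for d using finite_I by (intro finite_PiE) auto
  have NT: "n \<in> tuples" if "n \<in> ?N" for n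
    using that by (auto simp: tuples_def pos_upto_def PiE_iff)
  have D: "finite (divisors n)" if "n \<in> ?N" for n
    unfolding divisors_def using finite_I tuples_pos[OF NT[OF that]]
    by (intro finite_PiE) (auto intro: finite_divisors_nat)
  have "(\<Sum>n\<in>?N. euler F n) = (\<Sum>n\<in>?N. \<Sum>d\<in>divisors n. euler G d * (\<Prod>i\<in>I. real (tau (n i div d i))))"
    by (intro sum.cong refl euler_F_eq_conv NT)
  also have "\<dots> = (\<Sum>(n, d)\<in>Sigma ?N divisors. euler G d * (\<Prod>i\<in>I. real (tau (n i div d i))))"
    using N D by (subst sum.Sigma) auto
  also have "\<dots> = (\<Sum>(d, m)\<in>Sigma ?N ?M. euler G d * (\<Prod>i\<in>I. real (tau (m i))))"
  proof (rule sum.reindex_bij_witness[where i = "\<lambda>(d, m). (\<lambda>i\<in>I. d i * m i, d)"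
          and j = "\<lambda>(n, d). (d, \<lambda>i\<in>I. n i div d i)"])
    fix y assume "y \<in> Sigma ?N divisors"
    then obtain n d where y: "y = (n, d)" and n: "n \<in> ?N" and d: "d \<in> divisors n" by auto
    have dn: "d i dvd n i" "n i > 0" "real (n i) \<le> x" if "i \<in> I" for i
      using n d that by (auto simp: divisors_def pos_upto_def PiE_iff)
    have dp: "d i > 0" "d i \<le> n i" if "i \<in> I" for i
      using dn[OF that] by (auto intro: dvd_pos_nat dvd_imp_le)
    have "(\<lambda>i\<in>I. d i * (\<lambda>i\<in>I. n i div d i) i) = n"
      using n dn by (auto simp: fun_eq_iff PiE_iff extensional_def)
    then show "(case case y of (n, d) \<Rightarrow> (d, \<lambda>i\<in>I. n i div d i) of (d, m) \<Rightarrow> (\<lambda>i\<in>I. d i * m i, d)) = y"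
      unfolding y by simp
    have "d i \<in> pos_upto x" if "i \<in> I" for i
      using dp[OF that] dn[OF that] by (auto simp: pos_upto_def)
    then have "d \<in> ?N"
      using d by (auto simp: divisors_def PiE_iff)
    moreover have "(\<lambda>i\<in>I. n i div d i) \<in> ?M d"
    proof (rule restrict_PiE[THEN iffD2], rule)
      fix i assume i: "i \<in> I"
      have "real (n i div d i) = real (n i) / real (d i)" using dn[OF i] by (simp add: real_of_nat_div)
      also have "\<dots> \<le> x / real (d i)" using dn[OF i] by (intro divide_right_mono) auto
      finally show "n i div d i \<in> pos_upto (x / real (d i))"
        using dp[OF i] by (auto simp: pos_upto_def div_greater_zero_iff)
    qed
    ultimately show "(case y of (n, d) \<Rightarrow> (d, \<lambda>i\<in>I. n i div d i)) \<in> Sigma ?N ?M"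
      unfolding y by simp
    show "(case case y of (n, d) \<Rightarrow> (d, \<lambda>i\<in>I. n i div d i) of (d, m) \<Rightarrow> euler G d * (\<Prod>i\<in>I. real (tau (m i))))
        = (case y of (n, d) \<Rightarrow> euler G d * (\<Prod>i\<in>I. real (tau (n i div d i))))"
      unfolding y by simp
  next
    fix y assume "y \<in> Sigma ?N ?M"
    then obtain d m where y: "y = (d, m)" and d: "d \<in> ?N" and m: "m \<in> ?M d" by auto
    have dp: "d i > 0" "m i > 0" "real (m i) \<le> x / real (d i)" if "i \<in> I" for i
      using d m that by (auto simp: pos_upto_def PiE_iff)
    have "(\<lambda>i\<in>I. (\<lambda>i\<in>I. d i * m i) i div d i) = m"
      using m dp by (auto simp: fun_eq_iff PiE_iff extensional_def)
    then show "(case case y of (d, m) \<Rightarrow> (\<lambda>i\<in>I. d i * m i, d) of (n, d) \<Rightarrow> (d, \<lambda>i\<in>I. n i div d i)) = y"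
      unfolding y by simp
    have "(\<lambda>i\<in>I. d i * m i) \<in> ?N"
      using dp by (auto simp: pos_upto_def field_simps)
    moreover have "d \<in> divisors (\<lambda>i\<in>I. d i * m i)"
      using d by (auto simp: divisors_def PiE_iff)
    ultimately show "(case y of (d, m) \<Rightarrow> (\<lambda>i\<in>I. d i * m i, d)) \<in> Sigma ?N divisors"
      unfolding y by simp
  qed
  also have "\<dots> = (\<Sum>d\<in>?N. \<Sum>m\<in>?M d. euler G d * (\<Prod>i\<in>I. real (tau (m i))))"
    using N M by (subst sum.Sigma) auto
  also have "\<dots> = (\<Sum>d\<in>?N. euler G d * (\<Prod>i\<in>I. tau_sum (x / real (d i))))"
    using finite_I by (subst sum_distrib_left[symmetric]) (simp add: tau_sum_def prod_sum_PiE)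
  finally show ?thesis .
qed

text \<open>A tuple outside the range has an entry above \<open>x\<close>, and the corresponding
  factor is an empty sum. Extension to all tuples gives the index set of the main term, so that the
  two series can be compared term by term.\<close>

lemma has_sum_euler_G_tau_sum:
  "((\<lambda>d. euler G d * (\<Prod>i\<in>I. tau_sum (x / real (d i)))) has_sum (\<Sum>n\<in>I \<rightarrow>\<^sub>E pos_upto x. euler F n)) tuples"
proof (rule has_sum_finite_neutralI[where B = "I \<rightarrow>\<^sub>E pos_upto x"])
  show "finite (I \<rightarrow>\<^sub>E pos_upto x)" using finite_I by (intro finite_PiE) auto
  show "(I \<rightarrow>\<^sub>E pos_upto x) \<subseteq> tuples" by (auto simp: tuples_def pos_upto_def PiE_iff)
  show "(\<Sum>n\<in>I \<rightarrow>\<^sub>E pos_upto x. euler F n) = (\<Sum>d\<in>I \<rightarrow>\<^sub>E pos_upto x. euler G d * (\<Prod>i\<in>I. tau_sum (x / real (d i))))"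
    by (rule sum_euler_F_eq)
  fix d assume d: "d \<in> tuples - (I \<rightarrow>\<^sub>E pos_upto x)"
  then obtain i where i: "i \<in> I" "d i \<notin> pos_upto x" "d i > 0"
    by (auto simp: tuples_def PiE_iff)
  then have "x / real (d i) < 1" by (auto simp: pos_upto_def)
  then have "tau_sum (x / real (d i)) = 0" by (rule tau_sum_eq_0)
  then have "(\<Prod>i\<in>I. tau_sum (x / real (d i))) = 0" using finite_I i(1) by auto
  then show "euler G d * (\<Prod>i\<in>I. tau_sum (x / real (d i))) = 0" by simp
qed

text \<open>\<open>A\<close> is the set of coordinates that contribute \<open>ln x\<close> when the
  product of the factors ln x + (2 gamma - 1 - ln d_i) is expanded.\<close>

definition main_coeff :: "'a set \<Rightarrow> real" where
  "main_coeff A = infsum (\<lambda>d. euler G d * wt (\<lambda>_. 1) d * (\<Prod>i\<in>I - A. (2 * euler_mascheroni - 1) - ln (real (d i)))) tuples"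

definition main_poly :: "real poly" where
  "main_poly = (\<Sum>A\<in>Pow I. monom (main_coeff A) (card A))"

lemma wt_nonneg [simp]: "wt a d \<ge> 0"
  by (auto simp: wt_def intro!: prod_nonneg)

text \<open>Since ln d <= 4 d^(1/4), each logarithmic factor costs at most a constant times
  d_i^(1/4). The weight exponents drop from 1 to 3/4, which is still admissible because 3/4 + 3/4 >=
  5/4.\<close>

lemma summable_main_coeff:
  "(\<lambda>d. euler G d * wt (\<lambda>_. 1) d * (\<Prod>i\<in>I - A. (2 * euler_mascheroni - 1) - ln (real (d i)))) abs_summable_on tuples"
proof -
  let ?c = "2 * euler_mascheroni - 1 :: real"
  let ?L = "\<bar>?c\<bar> + 4"
  have "admissible (\<lambda>_. 3/4)" by (simp add: admissible_def)
  then have "(\<lambda>d. ?L ^ card (I - A) * norm (euler G d * wt (\<lambda>_. 3/4) d)) summable_on tuples"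
    by (intro summable_on_cmult_right abs_summable_euler_G)
  then show ?thesis
  proof (rule Infinite_Sum.abs_summable_on_comparison_test')
    fix d assume d: "d \<in> tuples"
    have d1: "real (d i) \<ge> 1" if "i \<in> I" for i using tuples_pos[OF d that] by simp
    have "\<bar>\<Prod>i\<in>I - A. ?c - ln (real (d i))\<bar> \<le> (\<Prod>i\<in>I - A. ?L * real (d i) powr (1/4))"
      unfolding abs_prod
    proof (intro prod_mono conjI)
      fix i assume i: "i \<in> I - A"
      have 1: "real (d i) powr (1/4) \<ge> 1" using d1 i by (auto intro: ge_one_powr_ge_zero)
      have "ln (real (d i)) \<le> real (d i) powr (1/4) / (1/4)"
        using d1 i by (intro ln_powr_bound) auto
      then have "ln (real (d i)) \<le> 4 * real (d i) powr (1/4)" by simp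
      moreover have "ln (real (d i)) \<ge> 0" using d1 i by auto
      moreover have "\<bar>?c\<bar> \<le> \<bar>?c\<bar> * real (d i) powr (1/4)"
        using 1 by (simp add: mult_le_cancel_left1)
      ultimately show "\<bar>?c - ln (real (d i))\<bar> \<le> ?L * real (d i) powr (1/4)"
        unfolding distrib_right by linarith
    qed auto
    also have "\<dots> = ?L ^ card (I - A) * (\<Prod>i\<in>I - A. real (d i) powr (1/4))"
      by (simp add: prod.distrib)
    also have "\<dots> \<le> ?L ^ card (I - A) * (\<Prod>i\<in>I. real (d i) powr (1/4))"
      using finite_I d1 by (intro mult_left_mono prod_mono2) (auto intro: ge_one_powr_ge_zero)
    finally have le: "\<bar>\<Prod>i\<in>I - A. ?c - ln (real (d i))\<bar> \<le> ?L ^ card (I - A) * (\<Prod>i\<in>I. real (d i) powr (1/4))" .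
    have w: "wt (\<lambda>_. 1) d * (\<Prod>i\<in>I. real (d i) powr (1/4)) = wt (\<lambda>_. 3/4) d"
      unfolding wt_def prod.distrib[symmetric] powr_add[symmetric] by (intro prod.cong) auto
    have "norm (euler G d * wt (\<lambda>_. 1) d * (\<Prod>i\<in>I - A. ?c - ln (real (d i))))
        = \<bar>euler G d\<bar> * wt (\<lambda>_. 1) d * \<bar>\<Prod>i\<in>I - A. ?c - ln (real (d i))\<bar>"
      by (simp add: abs_mult)
    also have "\<dots> \<le> \<bar>euler G d\<bar> * wt (\<lambda>_. 1) d * (?L ^ card (I - A) * (\<Prod>i\<in>I. real (d i) powr (1/4)))"
      by (intro mult_left_mono le) auto
    also have "\<dots> = ?L ^ card (I - A) * norm (euler G d * wt (\<lambda>_. 3/4) d)"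
      using w by (simp add: abs_mult mult_ac)
    finally show "norm (euler G d * wt (\<lambda>_. 1) d * (\<Prod>i\<in>I - A. ?c - ln (real (d i))))
        \<le> ?L ^ card (I - A) * norm (euler G d * wt (\<lambda>_. 3/4) d)" .
  qed
qed

text \<open>Expanding over subsets \<open>A\<close> and collecting powers of \<open>ln x\<close>
  gives the polynomial exactly: the series runs over all tuples, so there is no truncation
  error.\<close>

lemma has_sum_euler_G_tau_main:
  assumes "x > 0"
  shows "((\<lambda>d. euler G d * (\<Prod>i\<in>I. tau_main (x / real (d i)))) has_sum (x ^ card I * poly main_poly (ln x))) tuples"
proof -
  let ?c = "2 * euler_mascheroni - 1 :: real"
  let ?t = "\<lambda>A d. euler G d * wt (\<lambda>_. 1) d * (\<Prod>i\<in>I - A. ?c - ln (real (d i)))"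
  have 1: "((\<lambda>d. \<Sum>A\<in>Pow I. ?t A d * (x ^ card I * ln x ^ card A)) has_sum (\<Sum>A\<in>Pow I. main_coeff A * (x ^ card I * ln x ^ card A))) tuples"
    using finite_I abs_summable_summable[OF summable_main_coeff]
    by (intro has_sum_sum has_sum_cmult_left) (auto simp: main_coeff_def)
  have 2: "(\<Sum>A\<in>Pow I. main_coeff A * (x ^ card I * ln x ^ card A)) = x ^ card I * poly main_poly (ln x)"
    by (simp add: main_poly_def poly_sum poly_monom sum_distrib_left mult_ac)
  have 3: "(\<Sum>A\<in>Pow I. ?t A d * (x ^ card I * ln x ^ card A)) = euler G d * (\<Prod>i\<in>I. tau_main (x / real (d i)))"
    if d: "d \<in> tuples" for d
  proof -
    have "(\<Prod>i\<in>I. tau_main (x / real (d i))) = (\<Prod>i\<in>I. x * real (d i) powr - 1 * (ln x + (?c - ln (real (d i)))))"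
      using tuples_pos[OF d] assms by (intro prod.cong) (auto simp: tau_main_def ln_div powr_minus_divide)
    also have "\<dots> = x ^ card I * wt (\<lambda>_. 1) d * (\<Sum>A\<in>Pow I. (\<Prod>i\<in>A. ln x) * (\<Prod>i\<in>I - A. ?c - ln (real (d i))))"
      unfolding prod_add[OF finite_I, symmetric] by (simp only: prod.distrib wt_def prod_constant)
    finally show ?thesis by (simp add: sum_distrib_left mult_ac)
  qed
  show ?thesis
    using 1 unfolding 2 by (rule has_sum_cong[THEN iffD1, rotated]) (rule 3)
qed

lemma main_coeff_I: "main_coeff I = K"
  by (simp add: main_coeff_def K_def)

lemma coeff_main_poly: "coeff main_poly (card I) = K"
proof -
  have "coeff main_poly (card I) = (\<Sum>A\<in>Pow I. if card A = card I then main_coeff A else 0)"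
    by (simp add: main_poly_def coeff_sum)
  \<comment> \<open>Only \<open>A = I\<close> reaches full cardinality.\<close>
  also have "\<dots> = (\<Sum>A\<in>{I}. if card A = card I then main_coeff A else 0)"
    using finite_I by (intro sum.mono_neutral_right) (auto dest: card_subset_eq)
  finally show ?thesis by (simp add: main_coeff_I)
qed

text \<open>Exactness of the degree rests on \<open>K_nonzero\<close>.\<close>

lemma degree_main_poly: "degree main_poly = card I"
proof (rule antisym)
  show "degree main_poly \<le> card I"
    unfolding main_poly_def using finite_I
    by (intro degree_sum_le) (auto intro!: order_trans[OF degree_monom_le] card_mono)
  show "card I \<le> degree main_poly"
    using coeff_main_poly K_nonzero by (intro le_degree) simp
qed

text \<open>The two series over tuples are subtracted term by term and
  \<open>abs_prod_diff_le\<close> is applied. In its \<open>j\<close>-th term, coordinate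
  \<open>j\<close> carries the divisor error with exponent \<open>\<beta>\<close> and every other
  coordinate carries the majorant with exponent \<open>1 + s\<close> in \<open>x\<close>; the
  remaining series in \<open>d\<close> converge.\<close>

lemma sum_euler_F_bound:
  assumes O: "(\<lambda>x. tau_sum x - tau_main x) \<in> O[at_top](\<lambda>x. x powr (\<theta> + s))"
    and \<theta>: "1/4 \<le> \<theta>" "\<theta> < 1/3" and s: "0 < s" "s \<le> 1/4"
  obtains C where "\<And>x. x \<ge> 1 \<Longrightarrow> \<bar>(\<Sum>n\<in>I \<rightarrow>\<^sub>E pos_upto x. euler F n) - x ^ card I * poly main_poly (ln x)\<bar>
      \<le> C * x powr ((1 + s) * (real (card I) - 1) + (\<theta> + s))"
proof -
  define \<beta> where "\<beta> = \<theta> + s"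
  \<comment> \<open>The sum stays below 1/3 + 1/4 = 7/12.\<close>
  have \<beta>: "0 \<le> \<beta>" "\<beta> \<le> 3/4" using \<theta> s by (auto simp: \<beta>_def)
  obtain C1 where C1: "C1 \<ge> 0" "\<And>y. y > 0 \<Longrightarrow> \<bar>tau_sum y - tau_main y\<bar> \<le> C1 * y powr \<beta>"
    using abs_tau_error_le[OF O[folded \<beta>_def] \<beta>] by blast
  define C2 where "C2 = C1 + (2 / s + \<bar>2 * euler_mascheroni - 1\<bar> :: real)"
  have C2: "C2 \<ge> 0" using C1(1) s by (simp add: C2_def)
  define a where "a j = (\<lambda>i. if i = j then \<beta> else 1 - s)" for j :: 'a
  \<comment> \<open>The critical pair is \<open>\<beta> + (1 - s) = \<theta> + 1\<close>, which
    reaches 5/4 by \<open>\<theta> \<ge> 1/4\<close>; two coordinates other than \<open>j\<close>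
    give 2 - 2 s >= 3/2.\<close>
  have adm: "admissible (a j)" for j
    using \<theta> s by (auto simp: admissible_def a_def \<beta>_def)
  let ?r = "card I"
  let ?e = "(1 + s) * (real ?r - 1) + \<beta>"
  let ?Z = "C1 * C2 ^ (?r - 1)"
  let ?g = "\<lambda>j d. norm (euler G d * wt (a j) d)"
  have r: "?r \<ge> 1" using finite_I I_nonempty by (simp add: Suc_leI card_gt_0_iff)
  define C where "C = ?Z * (\<Sum>j\<in>I. infsum (?g j) tuples)"
  have "\<bar>(\<Sum>n\<in>I \<rightarrow>\<^sub>E pos_upto x. euler F n) - x ^ card I * poly main_poly (ln x)\<bar> \<le> C * x powr ?e"
    if x: "x \<ge> 1" for x
  proof -
    let ?f = "\<lambda>d. euler G d * (\<Prod>i\<in>I. tau_sum (x / real (d i))) - euler G d * (\<Prod>i\<in>I. tau_main (x / real (d i)))"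
    have f: "(?f has_sum ((\<Sum>n\<in>I \<rightarrow>\<^sub>E pos_upto x. euler F n) - x ^ card I * poly main_poly (ln x))) tuples"
      using has_sum_add[OF has_sum_euler_G_tau_sum has_sum_uminusI[OF has_sum_euler_G_tau_main]] x
      by simp
    have "((\<lambda>d. \<Sum>j\<in>I. (?Z * x powr ?e) * ?g j d) has_sum (\<Sum>j\<in>I. (?Z * x powr ?e) * infsum (?g j) tuples)) tuples"
      using finite_I abs_summable_euler_G[OF adm]
      by (intro has_sum_sum has_sum_cmult_right) auto
    moreover have "(\<Sum>j\<in>I. (?Z * x powr ?e) * infsum (?g j) tuples) = C * x powr ?e"
      by (simp add: C_def sum_distrib_left sum_distrib_right mult_ac)
    ultimately have g: "((\<lambda>d. \<Sum>j\<in>I. (?Z * x powr ?e) * ?g j d) has_sum (C * x powr ?e)) tuples"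
      by simp
    have "norm (?f d) \<le> (\<Sum>j\<in>I. (?Z * x powr ?e) * ?g j d)" if d: "d \<in> tuples" for d
    proof -
      have d1: "real (d i) \<ge> 1" if "i \<in> I" for i using tuples_pos[OF d that] by simp
      let ?m = "\<lambda>i. C2 * (x powr (1 + s) * real (d i) powr - (1 - s))"
      have "\<bar>(\<Prod>i\<in>I. tau_sum (x / real (d i))) - (\<Prod>i\<in>I. tau_main (x / real (d i)))\<bar>
          \<le> (\<Sum>j\<in>I. \<bar>tau_sum (x / real (d j)) - tau_main (x / real (d j))\<bar> * (\<Prod>i\<in>I - {j}. ?m i))"
      proof (rule abs_prod_diff_le[OF finite_I])
        fix i assume i: "i \<in> I"
        show "\<bar>tau_sum (x / real (d i))\<bar> \<le> ?m i"
          unfolding C2_def using x d1[OF i] s \<beta> by (intro tau_sum_le[OF C1]) auto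
        have "\<bar>tau_main (x / real (d i))\<bar> \<le> (2 / s + \<bar>2 * euler_mascheroni - 1\<bar>) * (x powr (1 + s) * real (d i) powr - (1 - s))"
          using x d1[OF i] s by (intro abs_tau_main_le) auto
        also have "\<dots> \<le> ?m i"
          unfolding C2_def using C1(1) by (intro mult_right_mono) auto
        finally show "\<bar>tau_main (x / real (d i))\<bar> \<le> ?m i" .
      qed
      also have "\<dots> \<le> (\<Sum>j\<in>I. (?Z * x powr ?e) * wt (a j) d)"
      proof (rule sum_mono)
        fix j assume j: "j \<in> I"
        have dj: "real (d j) \<ge> 1" by (rule d1[OF j])
        have cj: "card (I - {j}) = ?r - 1" using j finite_I by simp
        have "\<bar>tau_sum (x / real (d j)) - tau_main (x / real (d j))\<bar> \<le> C1 * (x / real (d j)) powr \<beta>"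
          using x dj by (intro C1(2)) auto
        also have "\<dots> = C1 * (x powr \<beta> * real (d j) powr - \<beta>)"
          using x dj by (simp add: powr_divide powr_minus_divide)
        finally have 1: "\<bar>tau_sum (x / real (d j)) - tau_main (x / real (d j))\<bar> \<le> C1 * (x powr \<beta> * real (d j) powr - \<beta>)" .
        have 2: "(\<Prod>i\<in>I - {j}. ?m i) = C2 ^ (?r - 1) * (x powr (1 + s)) ^ (?r - 1) * (\<Prod>i\<in>I - {j}. real (d i) powr - (1 - s))"
          by (simp add: prod.distrib cj)
        have 3: "wt (a j) d = real (d j) powr - \<beta> * (\<Prod>i\<in>I - {j}. real (d i) powr - (1 - s))"
          unfolding wt_def prod.remove[OF finite_I j] by (auto simp: a_def intro!: prod.cong)
        have 4: "x powr ?e = (x powr (1 + s)) ^ (?r - 1) * x powr \<beta>"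
        proof -
          have "(x powr (1 + s)) ^ (?r - 1) = x powr ((1 + s) * (real ?r - 1))"
            using x r by (subst powr_power) (auto simp: of_nat_diff mult.commute)
          then show ?thesis by (simp only: powr_add)
        qed
        have "\<bar>tau_sum (x / real (d j)) - tau_main (x / real (d j))\<bar> * (\<Prod>i\<in>I - {j}. ?m i)
          \<le> (C1 * (x powr \<beta> * real (d j) powr - \<beta>)) * (\<Prod>i\<in>I - {j}. ?m i)"
          using C2 by (intro mult_right_mono 1 prod_nonneg) auto
        also have "\<dots> = (?Z * x powr ?e) * wt (a j) d"
          unfolding 2 3 4 by (simp add: mult_ac)
        finally show "\<bar>tau_sum (x / real (d j)) - tau_main (x / real (d j))\<bar> * (\<Prod>i\<in>I - {j}. ?m i) \<le> (?Z * x powr ?e) * wt (a j) d" .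
      qed
      finally have "\<bar>euler G d\<bar> * \<bar>(\<Prod>i\<in>I. tau_sum (x / real (d i))) - (\<Prod>i\<in>I. tau_main (x / real (d i)))\<bar>
          \<le> \<bar>euler G d\<bar> * (\<Sum>j\<in>I. (?Z * x powr ?e) * wt (a j) d)"
        by (intro mult_left_mono) auto
      also have "\<dots> = (\<Sum>j\<in>I. (?Z * x powr ?e) * ?g j d)"
        by (simp add: sum_distrib_left abs_mult mult_ac)
      finally show ?thesis by (simp add: abs_mult flip: right_diff_distrib)
    qed
    then show ?thesis using norm_infsum_le[OF f g] by simp
  qed
  then show thesis using that[of C] by (simp add: \<beta>_def)
qed

theorem sum_euler_F_asymptotic:
  assumes O: "\<And>\<epsilon>::real. \<epsilon> > 0 \<Longrightarrow> (\<lambda>x. tau_sum x - tau_main x) \<in> O[at_top](\<lambda>x. x powr (\<theta> + \<epsilon>))"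
    and \<theta>: "1/4 \<le> \<theta>" "\<theta> < 1/3" and \<epsilon>: "\<epsilon> > 0"
  shows "(\<lambda>x. (\<Sum>n\<in>I \<rightarrow>\<^sub>E pos_upto x. euler F n) - x ^ card I * poly main_poly (ln x))
    \<in> O[at_top](\<lambda>x. x powr (real (card I) - 1 + \<theta> + \<epsilon>))"
proof -
  let ?r = "card I"
  have r: "?r \<ge> 1" using finite_I I_nonempty by (simp add: Suc_leI card_gt_0_iff)
  \<comment> \<open>The exponent loses \<open>s\<close> once for the error and once for each of the
    other r - 1 coordinates, in total r s, which must not exceed \<open>\<epsilon>\<close>.\<close>
  define s where "s = min (1/4) (\<epsilon> / real ?r)"
  have s: "0 < s" "s \<le> 1/4" using r \<epsilon> by (auto simp only: s_def min.cobounded1) auto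
  have "s * real ?r \<le> \<epsilon> / real ?r * real ?r" by (intro mult_right_mono) (auto simp: s_def)
  then have sr: "s * real ?r \<le> \<epsilon>" using r by simp
  obtain C where C: "\<And>x. x \<ge> 1 \<Longrightarrow> \<bar>(\<Sum>n\<in>I \<rightarrow>\<^sub>E pos_upto x. euler F n) - x ^ card I * poly main_poly (ln x)\<bar>
      \<le> C * x powr ((1 + s) * (real (card I) - 1) + (\<theta> + s))"
    using sum_euler_F_bound[OF O[OF s(1)] \<theta> s] by blast
  show ?thesis
  proof (rule bigoI[where c = "\<bar>C\<bar>"])
    show "eventually (\<lambda>x. norm ((\<Sum>n\<in>I \<rightarrow>\<^sub>E pos_upto x. euler F n) - x ^ card I * poly main_poly (ln x))
        \<le> \<bar>C\<bar> * norm (x powr (real (card I) - 1 + \<theta> + \<epsilon>))) at_top"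
      using eventually_ge_at_top[of 1]
    proof eventually_elim
      case (elim x)
      have "C * x powr ((1 + s) * (real ?r - 1) + (\<theta> + s)) \<le> \<bar>C\<bar> * x powr (real ?r - 1 + \<theta> + \<epsilon>)"
        using elim sr by (intro mult_mono powr_mono) (auto simp: algebra_simps)
      then show ?case using C[OF elim] by simp
    qed
  qed
qed

end

section \<open>The product and the least common multiple\<close>

lemma multiplicity_Lcm_image:
  fixes n :: "'a \<Rightarrow> nat"
  assumes "finite A" "A \<noteq> {}" "\<And>i. i \<in> A \<Longrightarrow> n i > 0" "prime p"
  shows "multiplicity p (LCM i\<in>A. n i) = Max ((\<lambda>i. multiplicity p (n i)) ` A)"
  using assms
proof (induction A rule: finite_ne_induct)
  case (insert x A)
  have "(LCM i\<in>A. n i) \<noteq> 0"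
    using insert.prems insert.hyps by (subst Lcm_0_iff) (auto simp: image_iff)
  then have "multiplicity p (LCM i\<in>insert x A. n i) = max (multiplicity p (n x)) (multiplicity p (LCM i\<in>A. n i))"
    using insert.prems by (simp add: multiplicity_lcm)
  also have "\<dots> = Max ((\<lambda>i. multiplicity p (n i)) ` insert x A)"
    using insert by simp
  finally show ?case .
qed simp

text \<open>Supplies \<open>F_le\<close> for the product directly, and for the least common multiple
  because a maximum is at most the sum.\<close>

lemma Suc_sum_le_prod_Suc:
  fixes \<nu> :: "'a \<Rightarrow> nat"
  assumes "finite A"
  shows "Suc (\<Sum>i\<in>A. \<nu> i) \<le> (\<Prod>i\<in>A. Suc (\<nu> i))"
  using assms
proof (induction A rule: finite_induct)
  case (insert x A)
  have "Suc (\<Sum>i\<in>insert x A. \<nu> i) \<le> Suc (\<nu> x) * Suc (\<Sum>i\<in>A. \<nu> i)"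
    using insert.hyps by simp
  also have "\<dots> \<le> Suc (\<nu> x) * (\<Prod>i\<in>A. Suc (\<nu> i))"
    by (rule mult_le_mono2[OF insert.IH])
  finally show ?case using insert.hyps by simp
qed simp

section \<open>The two instances of the local factor\<close>

lemma local_factor_sum:
  assumes "finite I" "I \<noteq> {}"
  shows "local_factor I (\<lambda>\<nu>. real (Suc (\<Sum>i\<in>I. \<nu> i)))"
proof
  fix i \<nu> assume "i \<in> I" "\<And>j. j \<in> I - {i} \<Longrightarrow> \<nu> j = (0::nat)"
  then show "real (Suc (\<Sum>i\<in>I. \<nu> i)) = real (Suc (\<nu> i))"
    using assms by (simp add: sum.remove[of I i])
next
  fix \<nu> :: "'a \<Rightarrow> nat"
  show "real (Suc (\<Sum>i\<in>I. \<nu> i)) \<le> (\<Prod>i\<in>I. real (Suc (\<nu> i)))"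
    unfolding of_nat_prod[symmetric] of_nat_le_iff by (rule Suc_sum_le_prod_Suc[OF assms(1)])
qed (use assms in \<open>auto simp del: of_nat_Suc\<close>)

lemma local_factor_Max:
  assumes "finite I" "I \<noteq> {}"
  shows "local_factor I (\<lambda>\<nu>. real (Suc (Max (\<nu> ` I))))"
proof
  fix i \<nu> assume "i \<in> I" "\<And>j. j \<in> I - {i} \<Longrightarrow> \<nu> j = (0::nat)"
  then have "Max (\<nu> ` I) = \<nu> i"
    using assms by (intro Max_eqI) fastforce+
  then show "real (Suc (Max (\<nu> ` I))) = real (Suc (\<nu> i))" by simp
next
  fix \<nu> :: "'a \<Rightarrow> nat"
  have "Max (\<nu> ` I) \<le> (\<Sum>i\<in>I. \<nu> i)"
    using assms by (intro Max.boundedI) (auto intro: member_le_sum)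
  then have "Suc (Max (\<nu> ` I)) \<le> (\<Prod>i\<in>I. Suc (\<nu> i))"
    using Suc_sum_le_prod_Suc[OF assms(1), of \<nu>] by linarith
  then show "real (Suc (Max (\<nu> ` I))) \<le> (\<Prod>i\<in>I. real (Suc (\<nu> i)))"
    unfolding of_nat_prod[symmetric] of_nat_le_iff .
qed (use assms in auto)

text \<open>As \<open>m\<close> divides the product of the entries, its primes all lie in
  \<open>supp n\<close>, and \<open>tau_eq_prod\<close> applies with that set. Each instance is thus
  reduced to an exponent formula at a single prime.\<close>

lemma (in local_factor) tau_eq_euler:
  assumes n: "n \<in> tuples" and m: "m dvd (\<Prod>i\<in>I. n i)"
    and F: "\<And>p. prime p \<Longrightarrow> F (mexp n p) = real (Suc (multiplicity p m))"
  shows "real (tau m) = euler F n"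
proof -
  have nz: "(\<Prod>i\<in>I. n i) > 0" using tuples_pos[OF n] by (simp add: prod_pos)
  have "tau m = (\<Prod>p\<in>supp n. Suc (multiplicity p m))"
  proof (rule tau_eq_prod)
    show "m > 0" using m nz by (rule dvd_pos_nat[rotated])
    show "prime_factors m \<subseteq> supp n"
      unfolding supp_def using m nz by (intro dvd_prime_factors) auto
  qed (auto simp: prime_supp)
  also have "real \<dots> = euler F n"
    unfolding euler_def of_nat_prod using F by (intro prod.cong) (auto simp: prime_supp)
  finally show ?thesis .
qed

lemma tau_prod_eq_euler:
  assumes "finite I" "I \<noteq> {}" "n \<in> local_factor.tuples I"
  shows "real (tau (\<Prod>i\<in>I. n i)) = local_factor.euler I (\<lambda>\<nu>. real (Suc (\<Sum>i\<in>I. \<nu> i))) n"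
proof -
  interpret local_factor I "\<lambda>\<nu>. real (Suc (\<Sum>i\<in>I. \<nu> i))"
    by (rule local_factor_sum[OF assms(1,2)])
  show ?thesis
  proof (rule tau_eq_euler[OF assms(3)])
    fix p :: nat assume "prime p"
    moreover have "0 \<notin> n ` I" using tuples_pos[OF assms(3)] by (metis imageE less_irrefl)
    ultimately have "multiplicity p (\<Prod>i\<in>I. n i) = (\<Sum>i\<in>I. multiplicity p (n i))"
      using assms(1) by (intro prime_elem_multiplicity_prod_distrib) auto
    then show "real (Suc (\<Sum>i\<in>I. mexp n p i)) = real (Suc (multiplicity p (\<Prod>i\<in>I. n i)))"
      by (simp add: mexp_def)
  qed simp
qed

lemma tau_lcm_eq_euler:
  assumes "finite I" "I \<noteq> {}" "n \<in> local_factor.tuples I"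
  shows "real (tau (LCM i\<in>I. n i)) = local_factor.euler I (\<lambda>\<nu>. real (Suc (Max (\<nu> ` I)))) n"
proof -
  interpret local_factor I "\<lambda>\<nu>. real (Suc (Max (\<nu> ` I)))"
    by (rule local_factor_Max[OF assms(1,2)])
  show ?thesis
  proof (rule tau_eq_euler[OF assms(3)])
    show "(LCM i\<in>I. n i) dvd (\<Prod>i\<in>I. n i)"
      using assms(1) by (intro Lcm_least) (auto intro: dvd_prodI)
    fix p :: nat assume "prime p"
    then have "multiplicity p (LCM i\<in>I. n i) = Max ((\<lambda>i. multiplicity p (n i)) ` I)"
      using tuples_pos[OF assms(3)] assms(1,2) by (intro multiplicity_Lcm_image) auto
    moreover have "mexp n p ` I = (\<lambda>i. multiplicity p (n i)) ` I"
      by (auto simp: mexp_def)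
    ultimately show "real (Suc (Max (mexp n p ` I))) = real (Suc (multiplicity p (LCM i\<in>I. n i)))"
      by simp
  qed
qed

text \<open>Split the weight into 1 and the single \<open>\<nu> j\<close>. The first part gives 1 /
  (1 - x)^r with r = \<open>card I\<close>; a weight \<open>\<nu> j\<close> replaces one geometric
  factor by x / (1 - x)^2. Over the common denominator the numerator is (1 - x) + r x.\<close>

lemma infsum_Suc_sum_power:
  fixes x :: real
  assumes I: "finite I" and x: "0 \<le> x" "x < 1"
  shows "infsum (\<lambda>\<nu>. real (Suc (\<Sum>i\<in>I. \<nu> i)) * x ^ (\<Sum>i\<in>I. \<nu> i)) (I \<rightarrow>\<^sub>E UNIV)
       = (1 + (real (card I) - 1) * x) / (1 - x) ^ (card I + 1)"
proof -
  let ?E = "I \<rightarrow>\<^sub>E (UNIV :: nat set)"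
  \<comment> \<open>\<open>h j\<close> marks coordinate \<open>j\<close>, which carries the weight
    \<open>k\<close>; the other coordinates keep the plain geometric series.\<close>
  define h where "h j = (\<lambda>i k. (if i = j then real k else 1) * x ^ k)" for j :: 'a
  have abs: "(\<lambda>k. x ^ k) abs_summable_on UNIV" "(\<lambda>k. real k * x ^ k) abs_summable_on UNIV"
    using has_sum_power[OF x] has_sum_mult_power[OF x] x by (auto simp: summable_on_def)
  then have habs: "h j i abs_summable_on UNIV" for i j
    by (cases "i = j") (simp_all add: h_def)
  have p0: "((\<lambda>\<nu>. \<Prod>i\<in>I. x ^ \<nu> i) has_sum (1 / (1 - x) ^ card I)) ?E"
  proof (rule has_sum_iff[THEN iffD2], rule conjI)
    show "(\<lambda>\<nu>. \<Prod>i\<in>I. x ^ \<nu> i) summable_on ?E"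
      by (intro abs_summable_summable[OF abs_summable_on_prod_PiE] I abs)
    show "infsum (\<lambda>\<nu>. \<Prod>i\<in>I. x ^ \<nu> i) ?E = 1 / (1 - x) ^ card I"
      using I abs by (subst infsum_prod_PiE_abs) (simp_all add: infsumI[OF has_sum_power[OF x]] power_one_over)
  qed
  have p1: "((\<lambda>\<nu>. \<Prod>i\<in>I. h j i (\<nu> i)) has_sum (x / (1 - x) ^ (card I + 1))) ?E" if j: "j \<in> I" for j
  proof (rule has_sum_iff[THEN iffD2], rule conjI)
    show "(\<lambda>\<nu>. \<Prod>i\<in>I. h j i (\<nu> i)) summable_on ?E"
      by (intro abs_summable_summable[OF abs_summable_on_prod_PiE] I habs)
    have "infsum (\<lambda>\<nu>. \<Prod>i\<in>I. h j i (\<nu> i)) ?E = (\<Prod>i\<in>I. infsum (h j i) UNIV)"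
      by (intro infsum_prod_PiE_abs I habs)
    also have "\<dots> = infsum (h j j) UNIV * (\<Prod>i\<in>I - {j}. infsum (h j i) UNIV)"
      by (rule prod.remove[OF I j])
    also have "infsum (h j j) UNIV = x / (1 - x)\<^sup>2"
      using infsumI[OF has_sum_mult_power[OF x]] by (simp add: h_def)
    also have "(\<Prod>i\<in>I - {j}. infsum (h j i) UNIV) = (\<Prod>i\<in>I - {j}. 1 / (1 - x))"
      using infsumI[OF has_sum_power[OF x]] by (intro prod.cong) (auto simp: h_def)
    also have "\<dots> = 1 / (1 - x) ^ (card I - 1)"
      using I j by (simp add: power_one_over)
    also have "x / (1 - x)\<^sup>2 * \<dots> = x / (1 - x) ^ (card I + 1)"
    proof -
      have "card I \<ge> 1" using I j by (auto simp: Suc_le_eq card_gt_0_iff)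
      then have "card I + 1 = 2 + (card I - 1)" by simp
      then show ?thesis by (simp only: power_add) simp
    qed
    finally show "infsum (\<lambda>\<nu>. \<Prod>i\<in>I. h j i (\<nu> i)) ?E = x / (1 - x) ^ (card I + 1)" .
  qed
  have h: "(\<Prod>i\<in>I. h j i (\<nu> i)) = real (\<nu> j) * x ^ (\<Sum>i\<in>I. \<nu> i)" if "j \<in> I" for j \<nu>
    using I that by (simp add: h_def prod.distrib power_sum)
  have "((\<lambda>\<nu>. (\<Prod>i\<in>I. x ^ \<nu> i) + (\<Sum>j\<in>I. \<Prod>i\<in>I. h j i (\<nu> i))) has_sum
      (1 / (1 - x) ^ card I + (\<Sum>j\<in>I. x / (1 - x) ^ (card I + 1)))) ?E"
    by (intro has_sum_add has_sum_sum p0 p1 I)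
  moreover have "(\<Prod>i\<in>I. x ^ \<nu> i) + (\<Sum>j\<in>I. \<Prod>i\<in>I. h j i (\<nu> i)) = real (Suc (\<Sum>i\<in>I. \<nu> i)) * x ^ (\<Sum>i\<in>I. \<nu> i)" for \<nu>
    by (simp add: h power_sum distrib_right sum_distrib_right)
  moreover have "1 / (1 - x) ^ card I + (\<Sum>j\<in>I. x / (1 - x) ^ (card I + 1)) = (1 + (real (card I) - 1) * x) / (1 - x) ^ (card I + 1)"
    using x by (simp add: divide_simps) (simp add: algebra_simps)
  ultimately show ?thesis by (simp add: infsumI)
qed

lemma has_prime_prod_cong:
  "(\<And>p. prime p \<Longrightarrow> f p = g p) \<Longrightarrow> has_prime_prod f a \<longleftrightarrow> has_prime_prod g a"
  unfolding has_prime_prod_def by (intro arg_cong[where f = "\<lambda>h. h has_prod a"] ext) simp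

text \<open>The power 2 r of 1 - 1/p meets the denominator exponent r + 1 of
  \<open>infsum_Suc_sum_power\<close>, which leaves r - 1.\<close>

lemma K_P_factor_eq:
  assumes r: "r \<ge> 1" and p: "prime p"
  shows "local_factor.K_factor {1..r} (\<lambda>\<nu>. real (Suc (\<Sum>i\<in>{1..r}. \<nu> i))) p = K_P_factor r p"
proof -
  interpret local_factor "{1..r}" "\<lambda>\<nu>. real (Suc (\<Sum>i\<in>{1..r}. \<nu> i))"
    using r by (intro local_factor_sum) auto
  define x where "x = 1 / real p"
  have x: "0 \<le> x" "x < 1" using prime_ge_2_nat[OF p] by (auto simp: x_def)
  have "2 * r = (r - 1) + (r + 1)" using r by simp
  then have "(1 - x) ^ (2 * r) = (1 - x) ^ (r - 1) * (1 - x) ^ (r + 1)"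
    by (simp only: power_add)
  moreover have "(real r - 1) / real p = (real r - 1) * x"
    by (simp add: x_def)
  moreover have "1 - x \<noteq> 0" using x by simp
  ultimately show ?thesis
    unfolding K_factor_def K_P_factor_def exps_def x_def[symmetric] infsum_Suc_sum_power[OF finite_I x]
    by simp
qed

lemma K_Q_factor_eq:
  assumes r: "r \<ge> 1"
  shows "local_factor.K_factor {1..r} (\<lambda>\<nu>. real (Suc (Max (\<nu> ` {1..r})))) p = K_Q_factor r p"
proof -
  interpret local_factor "{1..r}" "\<lambda>\<nu>. real (Suc (Max (\<nu> ` {1..r})))"
    using r by (intro local_factor_Max) auto
  show ?thesis
    unfolding K_factor_def K_Q_factor_def exps_def by (simp add: power_one_over add.commute)
qed

theorem theorem4:
  fixes r :: nat and \<theta> :: real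
  assumes "r \<ge> 2"
    and "1/4 \<le> \<theta>" and "\<theta> < 1/3"
    and "\<And>\<epsilon>::real. \<epsilon> > 0 \<Longrightarrow>
           (\<lambda>x::real. (\<Sum>n\<in>pos_upto x. real (tau n))
                        - (x * ln x + (2 * euler_mascheroni - 1) * x))
             \<in> O[at_top](\<lambda>x. x powr (\<theta> + \<epsilon>))"
  shows
    "(\<exists>P :: real poly. degree P = r \<and> has_prime_prod (K_P_factor r) (lead_coeff P) \<and>
        (\<forall>\<epsilon>>0. (\<lambda>x::real. tau_prod_sum r x - x ^ r * poly P (ln x))
                  \<in> O[at_top](\<lambda>x. x powr (real r - 1 + \<theta> + \<epsilon>)))) \<and>
     (\<exists>Q :: real poly. degree Q = r \<and> has_prime_prod (K_Q_factor r) (lead_coeff Q) \<and>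
        (\<forall>\<epsilon>>0. (\<lambda>x::real. tau_lcm_sum r x - x ^ r * poly Q (ln x))
                  \<in> O[at_top](\<lambda>x. x powr (real r - 1 + \<theta> + \<epsilon>))))"
proof -
  have I: "finite {1..r}" "{1..r} \<noteq> {}" "r \<ge> 1" using assms(1) by auto
  have O: "(\<lambda>x. tau_sum x - tau_main x) \<in> O[at_top](\<lambda>x. x powr (\<theta> + \<epsilon>))" if "\<epsilon> > 0" for \<epsilon>
    using assms(4)[OF that] by (simp add: tau_sum_def[abs_def] tau_main_def[abs_def] algebra_simps)
  interpret P: local_factor "{1..r}" "\<lambda>\<nu>. real (Suc (\<Sum>i\<in>{1..r}. \<nu> i))"
    by (rule local_factor_sum[OF I(1,2)])
  interpret Q: local_factor "{1..r}" "\<lambda>\<nu>. real (Suc (Max (\<nu> ` {1..r})))"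
    by (rule local_factor_Max[OF I(1,2)])
  \<comment> \<open>\<open>tuples\<close> depends on the index set only, so this fact serves the sum
    over least common multiples as well.\<close>
  have tuples: "n \<in> P.tuples" if "n \<in> {1..r} \<rightarrow>\<^sub>E pos_upto x" for n x
    using that unfolding P.tuples_def by (auto simp: pos_upto_def PiE_iff)
  have "tau_prod_sum r x = (\<Sum>n\<in>{1..r} \<rightarrow>\<^sub>E pos_upto x. P.euler (\<lambda>\<nu>. real (Suc (\<Sum>i\<in>{1..r}. \<nu> i))) n)" for x
    unfolding tau_prod_sum_def by (intro sum.cong refl tau_prod_eq_euler I tuples)
  then have "\<exists>P :: real poly. degree P = r \<and> has_prime_prod (K_P_factor r) (lead_coeff P) \<and>
        (\<forall>\<epsilon>>0. (\<lambda>x::real. tau_prod_sum r x - x ^ r * poly P (ln x))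
                  \<in> O[at_top](\<lambda>x. x powr (real r - 1 + \<theta> + \<epsilon>)))"
    using P.sum_euler_F_asymptotic[OF O assms(2,3)] P.degree_main_poly P.coeff_main_poly
      P.has_prime_prod_K has_prime_prod_cong[OF K_P_factor_eq[OF I(3)]]
    by (intro exI[of _ P.main_poly]) simp
  moreover have "tau_lcm_sum r x = (\<Sum>n\<in>{1..r} \<rightarrow>\<^sub>E pos_upto x. Q.euler (\<lambda>\<nu>. real (Suc (Max (\<nu> ` {1..r})))) n)" for x
    unfolding tau_lcm_sum_def by (intro sum.cong refl tau_lcm_eq_euler I tuples)
  then have "\<exists>Q :: real poly. degree Q = r \<and> has_prime_prod (K_Q_factor r) (lead_coeff Q) \<and>
        (\<forall>\<epsilon>>0. (\<lambda>x::real. tau_lcm_sum r x - x ^ r * poly Q (ln x))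
                  \<in> O[at_top](\<lambda>x. x powr (real r - 1 + \<theta> + \<epsilon>)))"
    using Q.sum_euler_F_asymptotic[OF O assms(2,3)] Q.degree_main_poly Q.coeff_main_poly
      Q.has_prime_prod_K has_prime_prod_cong[OF K_Q_factor_eq[OF I(3)]]
    by (intro exI[of _ Q.main_poly]) simp
  ultimately show ?thesis by blast
qed

end
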